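(* There is an absolute constant $u_0>0$ such that the following holds for every unit roundoff $0<\mathbf{u}\le u_0$. Let $k\ge2$, $n=2^k-1$, and let $B\in\mathbb{R}^{m\times m}$ and $\mathcal{R}_n\in\mathbb{R}^{n\times n}$ satisfy conditions (1) and (2) of the context. Let $0\le r\le k-2$ and $i\in\{2^{r+1},2\cdot2^{r+1},\dots,(2^{k-r-1}-1)\cdot2^{r+1}\}$. Let $0>\xi_1\ge\xi_2\ge\dots\ge\xi_{2^r-1}$ be the zeros of the matrix polynomial $B_{i-2^{r-1}}^{(r-1)}$, let $\varepsilon=\frac{15}{2}\mathbf{u}$, and let $\widetilde\xi_j<0$ be approximations with $|\widetilde\xi_j-\xi_j|<\varepsilon$ for all $j$. Let $b,\widetilde b\in\mathbb{R}^m$ with $\|\widetilde b-b\|_2<\delta$. Let $x_0=b$ and define $x_1,\dots,x_{2^r-1}$ recursively as the exact solutions of $$(B-\xi_{2^r-j}I)x_j=a_{i-2^r+j}\,x_{j-1},\qquad j=1,2,\dots,2^r-1 ,$$ where $a_2,\dots,a_n$ are the subdiagonal entries of $\mathcal{R}_n$. Then the computed solution $\widehat x_{2^r-1}$ (in the sense of the context, started from $\widehat x_0=\widetilde b$ and using the approximate zeros $\widetilde\xi_{2^r-j}$) satisfies $$\|\widehat x_{2^r-1}-x_{2^r-1}\|_2<\mathcal{C}_2(B_{i-2^{r-1}}^{(r-1)})\Big(\delta+41\,\mathbf{u}\,\mathcal{C}_3(B_{i-2^{r-1}}^{(r-1)})\,\|b\|_2\Big),$$ where $$\mathcal{C}_2(B_{i-2^{r-1}}^{(r-1)})=\prod_{j=1}^{2^r-1}\frac{|a_{i-j}|}{|\xi_j|},\qquad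 \mathcal{C}_3(B_{i-2^{r-1}}^{(r-1)})=\sum_{j=1}^{2^r-1}\frac{1}{|\xi_j|}.$$
   Context: Conditions. Write $b_1,\dots,b_n$ for the diagonal entries of $\mathcal{R}_n$, $a_2,\dots,a_n$ for its subdiagonal entries ($a_i$ in position $(i,i-1)$), $c_1,\dots,c_{n-1}$ for its superdiagonal entries, and $a_1=a_{n+1}=0$, $c_n=0$. (1) $B$ and $\mathcal{R}_n$ are symmetric positive definite tridiagonal matrices, and all subdiagonal entries of $\mathcal{R}_n$ are non-zero. (2) $\lambda_{\max}(\mathcal{R}_n)\le\max_{1\le i\le n}|b_i\pm(|a_i|+|a_{i+1}|)|\le1$, $\lambda_{\min}(\mathcal{R}_n)\ge\mathbf{u}^{1/2}$, $\lambda_{\max}(B)\le1$, $\lambda_{\min}(B)\ge\mathbf{u}^{1/2}$. Matrix polynomials. Put $\alpha_i^{(s)}=\prod_{j=i-2^s+1}^{i}a_j$ and $\gamma_i^{(s)}=\prod_{j=i}^{i+2^s-1}c_j$. Define $B_i^{(-1)}=I$ (for every index, including fractional ones), $B_i^{(0)}=B+b_iI$ for $i=1,\dots,n$, and, for $r=1,\dots,k-1$ and $i=2^r,2\cdot2^r,\dots,(2^{k-r}-1)\cdot2^r$, $$B_i^{(r)}=\big(\mathcal{D}_i^{(r)}\big)^{-1}\Big(\alpha_i^{(r-1)}\gamma_{i-2^{r-1}}^{(r-1)}B_{i+2^{r-2}}^{(r-2)}B_{i-3\cdot2^{r-2}}^{(r-2)}B_{i+2^{r-1}}^{(r-1)}-B_{i-2^{r-1}}^{(r-1)}B_i^{(r-1)}B_{i+2^{r-1}}^{(r-1)}+\alpha_{i+2^{r-1}}^{(r-1)}\gamma_i^{(r-1)}B_{i-2^{r-2}}^{(r-2)}B_{i+3\cdot2^{r-2}}^{(r-2)}B_{i-2^{r-1}}^{(r-1)}\Big),$$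 where $\mathcal{D}_i^{(r)}=B_{i-2^{r-2}}^{(r-2)}B_{i+2^{r-2}}^{(r-2)}$. Zeros of such a matrix polynomial mean the zeros of the corresponding scalar polynomial, obtained by replacing $B$ by an indeterminate $x$ and $I$ by $1$ and reading multiplication by $(\mathcal{D}_i^{(r)})^{-1}$ as (exact) division of polynomials. The polynomial $B_i^{(r)}$ has degree $2^{r+1}-1$, and under (1) its zeros are negative and simple. Empty products equal $1$ and empty sums equal $0$. Computed solution (floating-point model). Absolute values of matrices and matrix inequalities are componentwise, and $g(\mathbf{u})=\frac{4\mathbf{u}+3\mathbf{u}^2+\mathbf{u}^3}{1-\mathbf{u}}$. A computed solution $\widehat y$ by Gaussian elimination of a linear system $Ay=d$ with $A$ symmetric positive definite tridiagonal is a vector satisfying $(A+G)\widehat y=d$ for some matrix $G$ with $|G|\le g(\mathbf{u})|A|$. In the theorem, $\widehat x_0=\widetilde b$ and, for $j=1,\dots,2^r-1$, $\widehat x_j$ is a computed solution by Gaussian elimination of the system with coefficient matrix $B-\widetilde\xi_{2^r-j}I$ and right-hand side $a_{i-2^r+j}\,\widehat x_{j-1}$. *)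

theory Defs
  imports
    "Jordan_Normal_Form.Spectral_Radius"
begin

text \<open>Matrices and vectors are the size-carrying ones of \<open>Jordan_Normal_Form\<close>, so that the sizes
  may be quantified inside the statement. Their entries are indexed from 0, whereas the entries
  of the tridiagonal matrix are numbered from 1 below.\<close>

definition symmetric_mat :: "real mat \<Rightarrow> bool" where
  "symmetric_mat A \<longleftrightarrow> transpose_mat A = A"

definition positive_definite_mat :: "real mat \<Rightarrow> bool" where
  "positive_definite_mat A \<longleftrightarrow>
     (\<forall>v \<in> carrier_vec (dim_row A). v \<noteq> 0\<^sub>v (dim_row A) \<longrightarrow> v \<bullet> (A *\<^sub>v v) > 0)"

definition tridiagonal_mat :: "real mat \<Rightarrow> bool" where
  "tridiagonal_mat A \<longleftrightarrow>
     (\<forall>i < dim_row A. \<forall>j < dim_col A. (i + 1 < j \<or> j + 1 < i) \<longrightarrow> A $$ (i, j) = 0)"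

definition norm2 :: "real vec \<Rightarrow> real" where
  "norm2 v = sqrt (v \<bullet> v)"

text \<open>The extreme eigenvalues, only used for symmetric matrices of size at least 1, whose
  real spectrum is finite and nonempty.\<close>

definition lambda_max :: "real mat \<Rightarrow> real" where
  "lambda_max A = Max (spectrum A)"

definition lambda_min :: "real mat \<Rightarrow> real" where
  "lambda_min A = Min (spectrum A)"

definition diag_entry :: "real mat \<Rightarrow> nat \<Rightarrow> real" where
  "diag_entry R i = R $$ (i - 1, i - 1)"

definition sub_entry :: "real mat \<Rightarrow> nat \<Rightarrow> real" where
  "sub_entry R i = (if 2 \<le> i \<and> i \<le> dim_row R then R $$ (i - 1, i - 2) else 0)"

definition super_entry :: "real mat \<Rightarrow> nat \<Rightarrow> real" where
  "super_entry R i = (if 1 \<le> i \<and> i < dim_row R then R $$ (i - 1, i) else 0)"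

definition condition1 :: "real mat \<Rightarrow> real mat \<Rightarrow> bool" where
  "condition1 B R \<longleftrightarrow>
     symmetric_mat B \<and> positive_definite_mat B \<and> tridiagonal_mat B \<and>
     symmetric_mat R \<and> positive_definite_mat R \<and> tridiagonal_mat R \<and>
     (\<forall>i \<in> {2..dim_row R}. sub_entry R i \<noteq> 0)"

definition gershgorin_max :: "real mat \<Rightarrow> real" where
  "gershgorin_max R = Max (\<Union>i \<in> {1..dim_row R}.
     {\<bar>diag_entry R i + (\<bar>sub_entry R i\<bar> + \<bar>sub_entry R (i + 1)\<bar>)\<bar>,
      \<bar>diag_entry R i - (\<bar>sub_entry R i\<bar> + \<bar>sub_entry R (i + 1)\<bar>)\<bar>})"

definition condition2 :: "real \<Rightarrow> real mat \<Rightarrow> real mat \<Rightarrow> bool" where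
  "condition2 u B R \<longleftrightarrow>
     lambda_max R \<le> gershgorin_max R \<and> gershgorin_max R \<le> 1 \<and> lambda_min R \<ge> sqrt u \<and>
     lambda_max B \<le> 1 \<and> lambda_min B \<ge> sqrt u"

definition alpha_prod :: "real mat \<Rightarrow> nat \<Rightarrow> nat \<Rightarrow> real" where
  "alpha_prod R s i = (\<Prod>j = i + 1 - 2 ^ s..i. sub_entry R j)"

definition gamma_prod :: "real mat \<Rightarrow> nat \<Rightarrow> nat \<Rightarrow> real" where
  "gamma_prod R s i = (\<Prod>j = i..i + 2 ^ s - 1. super_entry R j)"

text \<open>\<open>B_poly R s i\<close> is the scalar polynomial (in the indeterminate replacing \<open>B\<close>) of the matrix
  polynomial \<open>B\<^sub>i\<^sup>(\<^sup>r\<^sup>)\<close> with \<open>r = s - 1\<close>: the superscript is shifted by one so that the level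
  \<open>-1\<close> becomes \<open>s = 0\<close>. In the third equation \<open>r = s + 1\<close>, \<open>h = 2 ^ (r - 1)\<close> and
  \<open>q = 2 ^ (r - 2)\<close>. For \<open>r = 1\<close> the number \<open>2 ^ (r - 2)\<close> is one half and is rounded to \<open>q = 0\<close>;
  this is harmless because it only occurs in indices of level \<open>-1\<close>, where the polynomial is 1 for
  every index. Only indices \<open>i = 2 ^ r, 2 * 2 ^ r, ..., (2 ^ (k - r) - 1) * 2 ^ r\<close> are meaningful;
  for them no subtraction of indices truncates, and the polynomial division is exact
  whenever \<open>condition1\<close> holds.\<close>

fun B_poly :: "real mat \<Rightarrow> nat \<Rightarrow> nat \<Rightarrow> real poly" where
  "B_poly R 0 i = 1"
| "B_poly R (Suc 0) i = [:diag_entry R i, 1:]"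
| "B_poly R (Suc (Suc s)) i =
    (let h = 2 ^ s; q = h div 2 in
      (Polynomial.smult (alpha_prod R s i * gamma_prod R s (i - h))
         (B_poly R s (i + q) * B_poly R s (i - 3 * q) * B_poly R (Suc s) (i + h))
       - B_poly R (Suc s) (i - h) * B_poly R (Suc s) i * B_poly R (Suc s) (i + h)
       + Polynomial.smult (alpha_prod R s (i + h) * gamma_prod R s i)
         (B_poly R s (i - q) * B_poly R s (i + 3 * q) * B_poly R (Suc s) (i - h)))
      div (B_poly R s (i - q) * B_poly R s (i + q)))"

definition g_bound :: "real \<Rightarrow> real" where
  "g_bound u = (4 * u + 3 * u\<^sup>2 + u ^ 3) / (1 - u)"

text \<open>\<open>computed_solution u A d y\<close>: \<open>y\<close> is a computed solution of \<open>A y = d\<close> by Gaussian elimination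
  with unit roundoff \<open>u\<close>; meant for square tridiagonal symmetric positive definite \<open>A\<close>.\<close>

definition computed_solution :: "real \<Rightarrow> real mat \<Rightarrow> real vec \<Rightarrow> real vec \<Rightarrow> bool" where
  "computed_solution u A d y \<longleftrightarrow>
     y \<in> carrier_vec (dim_col A) \<and>
     (\<exists>G \<in> carrier_mat (dim_row A) (dim_col A).
        (\<forall>i < dim_row A. \<forall>j < dim_col A. \<bar>G $$ (i, j)\<bar> \<le> g_bound u * \<bar>A $$ (i, j)\<bar>) \<and>
        (A + G) *\<^sub>v y = d)"

text \<open>Here \<open>\<xi> 1, ..., \<xi> (2 ^ r - 1)\<close> are the zeros, in decreasing order, of the polynomial
  with superscript \<open>r - 1\<close> and subscript \<open>i - 2 ^ (r - 1)\<close>.\<close>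

definition C2 :: "real mat \<Rightarrow> nat \<Rightarrow> nat \<Rightarrow> (nat \<Rightarrow> real) \<Rightarrow> real" where
  "C2 R r i \<xi> = (\<Prod>j = 1..2 ^ r - 1. \<bar>sub_entry R (i - j)\<bar> / \<bar>\<xi> j\<bar>)"

definition C3 :: "nat \<Rightarrow> (nat \<Rightarrow> real) \<Rightarrow> real" where
  "C3 r \<xi> = (\<Sum>j = 1..2 ^ r - 1. 1 / \<bar>\<xi> j\<bar>)"

end

theory Submission
  imports Defs
begin

text \<open>Up to sign, the polynomial \<open>B\<^sub>i\<^sup>(\<^sup>r\<^sup>)\<close> is the determinant of \<open>x I\<close> plus a principal block of
  \<open>R\<close>: the defining recursion combines two instances of Euler's identity for continuants. Since
  \<open>b\<^sub>j + \<bar>a\<^sub>j\<bar> + \<bar>a\<^sub>j\<^sub>+\<^sub>1\<bar> \<le> 1\<close>, such a block is strictly diagonally dominant for \<open>x < -1\<close>, so the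
  zeros lie in \<open>[-1, 0)\<close>. Each computed step therefore solves a system with matrix
  \<open>B - \<xi> I + E\<close>, \<open>\<parallel>E\<parallel> \<le> 33 u \<le> sqrt u \<le> \<lambda>\<^sub>m\<^sub>i\<^sub>n(B)\<close>; both this matrix and \<open>B - \<xi> I\<close> have inverses of
  norm at most \<open>1 / \<bar>\<xi>\<bar>\<close>. A step thus amplifies the error by at most \<open>\<bar>a\<bar> / \<bar>\<xi>\<bar>\<close> and adds at most
  \<open>33 u / \<bar>\<xi>\<bar>\<close> times the norm of the exact iterate.\<close>

section \<open>Quadratic forms and the Euclidean norm\<close>

lemma symmetric_mat_scalar_prod:
  assumes A: "A \<in> carrier_mat m m" and s: "symmetric_mat A"
    and v: "v \<in> carrier_vec m" and w: "w \<in> carrier_vec m"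
  shows "w \<bullet> (A *\<^sub>v v) = v \<bullet> (A *\<^sub>v w)"
proof -
  have "w \<bullet> (A *\<^sub>v v) = (transpose_mat A *\<^sub>v w) \<bullet> v"
    using assoc_scalar_prod[OF w A v] A v w
    by (simp add: mult_mat_vec_def scalar_prod_def mult.commute)
  also have "\<dots> = v \<bullet> (A *\<^sub>v w)"
    using s A v w unfolding symmetric_mat_def by (simp add: comm_scalar_prod[of _ m])
  finally show ?thesis .
qed

lemma scalar_prod_self_nonneg: "(v :: real vec) \<bullet> v \<ge> 0"
  by (simp add: scalar_prod_def sum_nonneg)

text \<open>For \<open>c > 0\<close> the polynomial is evaluated at its minimiser
  \<open>- b / c\<close>. For \<open>c = 0\<close> it is affine in \<open>t\<close>, and a nonzero
  slope would make it negative somewhere.\<close>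

lemma quadratic_nonneg_discriminant:
  fixes a b c :: real
  assumes "c \<ge> 0" and "\<And>t. a + 2 * t * b + t\<^sup>2 * c \<ge> 0"
  shows "b\<^sup>2 \<le> a * c"
proof (cases "c = 0")
  case True
  have "b = 0"
  proof (rule ccontr)
    assume "b \<noteq> 0"
    \<comment> \<open>At this \<open>t\<close> the affine function takes the value
      \<open>a - (a + 1) = - 1\<close>.\<close>
    with assms(2)[of "- (a + 1) / (2 * b)"] True show False by (simp add: field_simps)
  qed
  with True show ?thesis by simp
next
  case False
  then show ?thesis using assms(2)[of "- b / c"] assms(1)
    by (simp add: field_simps power2_eq_square)
qed

text \<open>The form is nonnegative along the line \<open>v + t w\<close>, and symmetry merges the
  two mixed terms, so the discriminant bound applies. Definiteness is not assumed, so that shifted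
  matrices at the edge of positivity are covered.\<close>

lemma psd_Cauchy_Schwarz:
  assumes A: "A \<in> carrier_mat m m" and s: "symmetric_mat A"
    and psd: "\<And>v. v \<in> carrier_vec m \<Longrightarrow> v \<bullet> (A *\<^sub>v v) \<ge> 0"
    and v: "v \<in> carrier_vec m" and w: "w \<in> carrier_vec m"
  shows "(v \<bullet> (A *\<^sub>v w))\<^sup>2 \<le> (v \<bullet> (A *\<^sub>v v)) * (w \<bullet> (A *\<^sub>v w))"
proof (rule quadratic_nonneg_discriminant)
  show "w \<bullet> (A *\<^sub>v w) \<ge> 0" by (rule psd[OF w])
  fix t
  have Av: "A *\<^sub>v v \<in> carrier_vec m" and Aw: "A *\<^sub>v w \<in> carrier_vec m"
    using A v w by auto
  have "0 \<le> (v + t \<cdot>\<^sub>v w) \<bullet> (A *\<^sub>v (v + t \<cdot>\<^sub>v w))"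
    using v w by (intro psd) auto
  also have "A *\<^sub>v (v + t \<cdot>\<^sub>v w) = A *\<^sub>v v + t \<cdot>\<^sub>v (A *\<^sub>v w)"
    using A v w by (simp add: mult_add_distrib_mat_vec mult_mat_vec)
  also have "(v + t \<cdot>\<^sub>v w) \<bullet> (A *\<^sub>v v + t \<cdot>\<^sub>v (A *\<^sub>v w)) =
      v \<bullet> (A *\<^sub>v v) + t * (v \<bullet> (A *\<^sub>v w)) + t * (w \<bullet> (A *\<^sub>v v)) + t * t * (w \<bullet> (A *\<^sub>v w))"
    using v w Av Aw
    by (simp add: add_scalar_prod_distrib[of _ m] scalar_prod_add_distrib[of _ m] algebra_simps)
  finally show "0 \<le> v \<bullet> (A *\<^sub>v v) + 2 * t * (v \<bullet> (A *\<^sub>v w)) + t\<^sup>2 * (w \<bullet> (A *\<^sub>v w))"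
    using symmetric_mat_scalar_prod[OF A s v w] by (simp add: power2_eq_square algebra_simps)
qed

section \<open>The Euclidean norm and Schur's test for matrices\<close>

lemma norm2_nonneg [simp]: "norm2 v \<ge> 0"
  by (simp add: norm2_def scalar_prod_self_nonneg)

lemma norm2_square: "(norm2 v)\<^sup>2 = v \<bullet> v"
  by (simp add: norm2_def scalar_prod_self_nonneg)

lemma norm2_smult: "norm2 (c \<cdot>\<^sub>v v) = \<bar>c\<bar> * norm2 v"
proof -
  have "(c \<cdot>\<^sub>v v) \<bullet> (c \<cdot>\<^sub>v v) = c\<^sup>2 * (v \<bullet> v)"
    by (simp add: power2_eq_square)
  then show ?thesis by (simp add: norm2_def real_sqrt_mult)
qed

lemma scalar_prod_le_norm2:
  assumes v: "v \<in> carrier_vec m" and w: "w \<in> carrier_vec m"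
  shows "\<bar>v \<bullet> w\<bar> \<le> norm2 v * norm2 w"
proof -
  have "(v \<bullet> (1\<^sub>m m *\<^sub>v w))\<^sup>2 \<le> (v \<bullet> (1\<^sub>m m *\<^sub>v v)) * (w \<bullet> (1\<^sub>m m *\<^sub>v w))"
    by (rule psd_Cauchy_Schwarz[OF _ _ _ v w]) (auto simp: symmetric_mat_def scalar_prod_self_nonneg)
  then have "(v \<bullet> w)\<^sup>2 \<le> (norm2 v * norm2 w)\<^sup>2"
    using v w by (simp add: power_mult_distrib norm2_square)
  then show ?thesis by (simp add: abs_le_square_iff[symmetric])
qed

lemma norm2_triangle:
  assumes v: "v \<in> carrier_vec m" and w: "w \<in> carrier_vec m"
  shows "norm2 (v + w) \<le> norm2 v + norm2 w"
proof -
  have "(norm2 (v + w))\<^sup>2 = v \<bullet> v + 2 * (v \<bullet> w) + w \<bullet> w"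
    using v w by (simp add: norm2_square add_scalar_prod_distrib[of _ m]
        scalar_prod_add_distrib[of _ m] comm_scalar_prod[of w m v])
  also have "\<dots> \<le> (norm2 v + norm2 w)\<^sup>2"
    using scalar_prod_le_norm2[OF v w] by (simp add: power2_sum norm2_square)
  finally show ?thesis by (rule power2_le_imp_le) simp
qed

text \<open>Schur's test with one bound for rows and columns. With \<open>y = A v\<close>, each term
  of \<open>2 t (y \<bullet> y)\<close> is split by the inequality of arithmetic and geometric
  means, weighted by the modulus of the entry; row sums control the \<open>y\<close> part and column
  sums the \<open>v\<close> part. The discriminant bound then optimises over
  \<open>t\<close>.\<close>

lemma norm2_mult_mat_vec_le:
  assumes A: "(A :: real mat) \<in> carrier_mat m m" and v: "v \<in> carrier_vec m"
    and rows: "\<And>i. i < m \<Longrightarrow> (\<Sum>j<m. \<bar>A $$ (i, j)\<bar>) \<le> K"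
    and cols: "\<And>j. j < m \<Longrightarrow> (\<Sum>i<m. \<bar>A $$ (i, j)\<bar>) \<le> K"
    and K: "K \<ge> 0"
  shows "norm2 (A *\<^sub>v v) \<le> K * norm2 v"
proof -
  define y where "y = A *\<^sub>v v"
  have y: "y \<in> carrier_vec m" using A v by (simp add: y_def)
  have *: "2 * t * (y \<bullet> y) \<le> K * (y \<bullet> y) + t\<^sup>2 * (K * (v \<bullet> v))" for t
  proof -
    have yy: "y \<bullet> y = (\<Sum>i<m. y $ i * y $ i)"
      using y by (simp add: scalar_prod_def lessThan_atLeast0)
    have vv: "v \<bullet> v = (\<Sum>i<m. v $ i * v $ i)"
      using v by (simp add: scalar_prod_def lessThan_atLeast0)
    have yi: "y $ i = (\<Sum>j<m. A $$ (i, j) * v $ j)" if "i < m" for i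
      using A v that by (simp add: y_def scalar_prod_def lessThan_atLeast0)
    have "2 * t * (y \<bullet> y) = (\<Sum>i<m. \<Sum>j<m. A $$ (i, j) * (2 * t * (y $ i * v $ j)))"
    proof -
      have "y \<bullet> y = (\<Sum>i<m. y $ i * (\<Sum>j<m. A $$ (i, j) * v $ j))"
        unfolding yy by (intro sum.cong refl) (simp flip: yi)
      then show ?thesis by (simp add: sum_distrib_left mult_ac)
    qed
    also have "\<dots> \<le> (\<Sum>i<m. \<Sum>j<m. \<bar>A $$ (i, j)\<bar> * (y $ i * y $ i) + \<bar>A $$ (i, j)\<bar> * (t\<^sup>2 * (v $ j * v $ j)))"
    proof (intro sum_mono)
      fix i j
      \<comment> \<open>The two signs come from the squares of \<open>y $ i - t * v $ j\<close> and
        \<open>y $ i + t * v $ j\<close>.\<close>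
      have "\<bar>2 * t * (y $ i * v $ j)\<bar> \<le> y $ i * y $ i + t\<^sup>2 * (v $ j * v $ j)"
        using zero_le_power2[of "y $ i - t * v $ j"] zero_le_power2[of "y $ i + t * v $ j"]
        by (simp add: power2_eq_square algebra_simps abs_le_iff)
      then have "\<bar>A $$ (i, j)\<bar> * \<bar>2 * t * (y $ i * v $ j)\<bar> \<le> \<bar>A $$ (i, j)\<bar> * (y $ i * y $ i + t\<^sup>2 * (v $ j * v $ j))"
        by (intro mult_left_mono) auto
      then show "A $$ (i, j) * (2 * t * (y $ i * v $ j)) \<le> \<bar>A $$ (i, j)\<bar> * (y $ i * y $ i) + \<bar>A $$ (i, j)\<bar> * (t\<^sup>2 * (v $ j * v $ j))"
        unfolding abs_mult[symmetric] by (simp add: distrib_left)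
    qed
    also have "\<dots> = (\<Sum>i<m. (\<Sum>j<m. \<bar>A $$ (i, j)\<bar>) * (y $ i * y $ i)) + (\<Sum>j<m. (\<Sum>i<m. \<bar>A $$ (i, j)\<bar>) * (t\<^sup>2 * (v $ j * v $ j)))"
      by (simp add: sum.distrib sum_distrib_right
          sum.swap[of "\<lambda>i j. \<bar>A $$ (i, j)\<bar> * (t\<^sup>2 * (v $ j * v $ j))" "{..<m}" "{..<m}"])
    also have "\<dots> \<le> (\<Sum>i<m. K * (y $ i * y $ i)) + (\<Sum>j<m. K * (t\<^sup>2 * (v $ j * v $ j)))"
      by (intro add_mono sum_mono mult_right_mono rows cols) auto
    also have "\<dots> = K * (y \<bullet> y) + t\<^sup>2 * (K * (v \<bullet> v))"
      unfolding yy vv by (simp add: sum_distrib_left mult_ac)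
    finally show ?thesis .
  qed
  have "(y \<bullet> y)\<^sup>2 \<le> (K * (y \<bullet> y)) * (K * (v \<bullet> v))"
  proof (rule quadratic_nonneg_discriminant)
    show "K * (v \<bullet> v) \<ge> 0" using K by (simp add: scalar_prod_self_nonneg)
    show "0 \<le> K * (y \<bullet> y) + 2 * t * (y \<bullet> y) + t\<^sup>2 * (K * (v \<bullet> v))" for t
      using *[of "- t"] by simp
  qed
  then have "((norm2 y)\<^sup>2) * (norm2 y)\<^sup>2 \<le> (norm2 y)\<^sup>2 * (K * norm2 v)\<^sup>2"
    by (simp add: norm2_square power_mult_distrib) (simp add: power2_eq_square mult_ac)
  then have "norm2 y = 0 \<or> (norm2 y)\<^sup>2 \<le> (K * norm2 v)\<^sup>2"
    by (cases "norm2 y = 0") (simp_all only: mult_le_cancel_left_pos zero_less_power2 simp_thms)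
  then show ?thesis using K unfolding y_def[symmetric] 
    by (auto intro: power2_le_imp_le)
qed

text \<open>The sum of all moduli dominates every row and column sum. The value of \<open>K\<close>
  is irrelevant later; only its existence matters.\<close>

lemma norm2_mult_mat_vec_bounded:
  assumes A: "(A :: real mat) \<in> carrier_mat m m"
  obtains K where "K \<ge> 0" "\<And>v. v \<in> carrier_vec m \<Longrightarrow> norm2 (A *\<^sub>v v) \<le> K * norm2 v"
proof
  let ?K = "\<Sum>i<m. \<Sum>j<m. \<bar>A $$ (i, j)\<bar>"
  show K: "?K \<ge> 0" by (simp add: sum_nonneg)
  fix v :: "real vec" assume v: "v \<in> carrier_vec m"
  show "norm2 (A *\<^sub>v v) \<le> ?K * norm2 v"
  proof (rule norm2_mult_mat_vec_le[OF A v _ _ K])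
    show "(\<Sum>j<m. \<bar>A $$ (i, j)\<bar>) \<le> ?K" if "i < m" for i
      using that by (intro member_le_sum[of i "{..<m}" "\<lambda>i. \<Sum>j<m. \<bar>A $$ (i, j)\<bar>"]) (auto simp: sum_nonneg)
    show "(\<Sum>i<m. \<bar>A $$ (i, j)\<bar>) \<le> ?K" if "j < m" for j
      using that by (intro sum_mono member_le_sum[of j]) auto
  qed
qed

section \<open>Extreme eigenvalues and the Rayleigh quotient\<close>

lemma char_matrix_mult_vec:
  assumes A: "(A :: real mat) \<in> carrier_mat m m" and v: "v \<in> carrier_vec m"
  shows "char_matrix A e *\<^sub>v v = A *\<^sub>v v - e \<cdot>\<^sub>v v"
  using A v unfolding char_matrix_def
  by (subst add_mult_distrib_mat_vec[of _ m m]) (auto intro!: eq_vecI)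

text \<open>The eigenvalue is the infimum of the Rayleigh quotient; were the shifted matrix \<open>C\<close>
  invertible, Cauchy--Schwarz for the form of \<open>C\<close>, applied to \<open>v\<close> and \<open>C\<^sup>-\<^sup>1 v\<close>, would
  bound that form away from zero.\<close>

lemma symmetric_mat_min_eigenvalue:
  assumes A: "A \<in> carrier_mat m m" and s: "symmetric_mat A" and m: "m \<ge> 1"
  obtains \<mu> where "eigenvalue A \<mu>" "\<And>v. v \<in> carrier_vec m \<Longrightarrow> \<mu> * (v \<bullet> v) \<le> v \<bullet> (A *\<^sub>v v)"
proof
  define S where "S = {t. \<forall>v \<in> carrier_vec m. t * (v \<bullet> v) \<le> v \<bullet> (A *\<^sub>v v)}"
  define \<mu> where "\<mu> = Sup S"
  obtain K where K: "K \<ge> 0" "\<And>v. v \<in> carrier_vec m \<Longrightarrow> norm2 (A *\<^sub>v v) \<le> K * norm2 v"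
    using norm2_mult_mat_vec_bounded[OF A] by blast
  \<comment> \<open>This makes \<open>S\<close> nonempty; the first unit vector, available because
    \<open>m \<ge> 1\<close>, bounds it above. Hence its supremum is meaningful.\<close>
  have "- K \<in> S" unfolding S_def
  proof safe
    fix v :: "real vec" assume v: "v \<in> carrier_vec m"
    have "\<bar>v \<bullet> (A *\<^sub>v v)\<bar> \<le> norm2 v * norm2 (A *\<^sub>v v)"
      using A v by (intro scalar_prod_le_norm2) auto
    also have "\<dots> \<le> norm2 v * (K * norm2 v)" by (intro mult_left_mono K v) auto
    finally show "- K * (v \<bullet> v) \<le> v \<bullet> (A *\<^sub>v v)"
      by (simp add: norm2_square[symmetric] power2_eq_square mult_ac)
  qed
  have "unit_vec m 0 \<bullet> unit_vec m 0 = (1 :: real)" using m by simp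
  then have "t \<le> unit_vec m 0 \<bullet> (A *\<^sub>v unit_vec m 0)" if "t \<in> S" for t
  proof -
    have "t * (unit_vec m 0 \<bullet> unit_vec m 0) \<le> unit_vec m 0 \<bullet> (A *\<^sub>v unit_vec m 0)"
      using that unit_vec_carrier unfolding S_def by blast
    then show ?thesis using \<open>unit_vec m 0 \<bullet> unit_vec m 0 = 1\<close> by simp
  qed
  then have bdd: "bdd_above S" by (rule bdd_aboveI)
  show form: "\<mu> * (v \<bullet> v) \<le> v \<bullet> (A *\<^sub>v v)" if v: "v \<in> carrier_vec m" for v
  proof (cases "v \<bullet> v = 0")
    case True
    with \<open>- K \<in> S\<close> v show ?thesis unfolding S_def by force
  next
    case False
    then have pos: "v \<bullet> v > 0" using scalar_prod_self_nonneg[of v] by simp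
    have "\<mu> \<le> (v \<bullet> (A *\<^sub>v v)) / (v \<bullet> v)" unfolding \<mu>_def
    proof (rule cSup_least)
      show "S \<noteq> {}" using \<open>- K \<in> S\<close> by blast
      show "t \<le> (v \<bullet> (A *\<^sub>v v)) / (v \<bullet> v)" if "t \<in> S" for t
        using that v pos by (auto simp: S_def field_simps)
    qed
    with pos show ?thesis by (simp add: field_simps)
  qed
  define C where "C = char_matrix A \<mu>"
  have C: "C \<in> carrier_mat m m" using A by (simp add: C_def)
  have Cv: "v \<bullet> (C *\<^sub>v v) = v \<bullet> (A *\<^sub>v v) - \<mu> * (v \<bullet> v)" if "v \<in> carrier_vec m" for v
    using A that by (simp add: C_def char_matrix_mult_vec scalar_prod_minus_distrib[of _ m])
  have symC: "symmetric_mat C" 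
    using s A unfolding symmetric_mat_def C_def char_matrix_def
    by (auto simp: transpose_add[of _ m m])
  show "eigenvalue A \<mu>"
  proof (rule ccontr)
    assume "\<not> eigenvalue A \<mu>"
    then have "det C \<noteq> 0" using eigenvalue_det[OF A] by (simp add: C_def)
    from det_non_zero_imp_unit[OF C this, of "()"]
    obtain D where D: "D \<in> carrier_mat m m" "C * D = 1\<^sub>m m"
      by (auto simp: Units_def ring_mat_simps)
    obtain L where L: "L \<ge> 0" "\<And>v. v \<in> carrier_vec m \<Longrightarrow> norm2 (D *\<^sub>v v) \<le> L * norm2 v"
      using norm2_mult_mat_vec_bounded[OF D(1)] by blast
    \<comment> \<open>A member of \<open>S\<close> above its supremum. Using \<open>L + 1\<close>
      instead of \<open>L\<close> keeps the denominator positive when \<open>L = 0\<close>.\<close>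
    have "\<mu> + 1 / (L + 1) \<in> S" unfolding S_def
    proof safe
      fix v :: "real vec" assume v: "v \<in> carrier_vec m"
      define w where "w = D *\<^sub>v v"
      have w: "w \<in> carrier_vec m" using D v by (simp add: w_def)
      have Cw: "C *\<^sub>v w = v" using C D v by (simp add: w_def flip: assoc_mult_mat_vec)
      have q: "v \<bullet> (C *\<^sub>v v) \<ge> 0" using Cv[OF v] form[OF v] by simp
      have "(v \<bullet> v)\<^sup>2 \<le> (v \<bullet> (C *\<^sub>v v)) * (w \<bullet> v)"
        using psd_Cauchy_Schwarz[OF C symC _ v w] Cv form Cw by simp
      also have "\<dots> \<le> (v \<bullet> (C *\<^sub>v v)) * ((L + 1) * (v \<bullet> v))"
      proof (rule mult_left_mono[OF _ q])
        have "w \<bullet> v \<le> norm2 w * norm2 v" using scalar_prod_le_norm2[OF w v] by simp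
        also have "\<dots> \<le> (L * norm2 v) * norm2 v"
          unfolding w_def by (intro mult_right_mono L v) auto
        also have "\<dots> \<le> (L + 1) * (v \<bullet> v)"
          by (simp add: norm2_square[symmetric] power2_eq_square algebra_simps)
        finally show "w \<bullet> v \<le> (L + 1) * (v \<bullet> v)" .
      qed
      finally have "(v \<bullet> v) * (v \<bullet> v) \<le> (v \<bullet> v) * ((L + 1) * (v \<bullet> (C *\<^sub>v v)))"
        by (simp add: power2_eq_square mult_ac)
      then have "v \<bullet> v \<le> (L + 1) * (v \<bullet> (C *\<^sub>v v))"
        using scalar_prod_self_nonneg[of v] q L
        by (cases "v \<bullet> v = 0") (auto simp: mult_le_cancel_left)
      then have "(v \<bullet> v) / (L + 1) \<le> v \<bullet> (C *\<^sub>v v)" using L by (simp add: field_simps)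
      then show "(\<mu> + 1 / (L + 1)) * (v \<bullet> v) \<le> v \<bullet> (A *\<^sub>v v)"
        using Cv[OF v] by (simp add: algebra_simps)
    qed
    then have "\<mu> + 1 / (L + 1) \<le> \<mu>" unfolding \<mu>_def by (rule cSup_upper[OF _ bdd])
    with L show False by (simp add: field_simps)
  qed
qed

text \<open>Some eigenvalue bounds the form from below, and the minimum of the finite spectrum is at
  most that eigenvalue. Size 0 is separated because the spectrum is then empty.\<close>

lemma lambda_min_le_form:
  assumes A: "A \<in> carrier_mat m m" and s: "symmetric_mat A" and v: "v \<in> carrier_vec m"
  shows "lambda_min A * (v \<bullet> v) \<le> v \<bullet> (A *\<^sub>v v)"
proof (cases "m = 0")
  case True
  with A v show ?thesis by (simp add: scalar_prod_def)
next
  case False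
  then obtain \<mu> where \<mu>: "eigenvalue A \<mu>" "\<And>v. v \<in> carrier_vec m \<Longrightarrow> \<mu> * (v \<bullet> v) \<le> v \<bullet> (A *\<^sub>v v)"
    using symmetric_mat_min_eigenvalue[OF A s] by auto
  have "lambda_min A \<le> \<mu>" unfolding lambda_min_def
    using \<mu>(1) card_finite_spectrum(1)[OF A] by (intro Min_le) (auto simp: spectrum_def)
  then have "lambda_min A * (v \<bullet> v) \<le> \<mu> * (v \<bullet> v)"
    by (intro mult_right_mono scalar_prod_self_nonneg)
  with \<mu>(2)[OF v] show ?thesis by simp
qed

lemma eigenvalue_uminus:
  assumes A: "(A :: real mat) \<in> carrier_mat m m" and e: "eigenvalue (- A) \<mu>"
  shows "eigenvalue A (- \<mu>)"
proof -
  obtain v where v: "v \<in> carrier_vec m" "v \<noteq> 0\<^sub>v m" "- A *\<^sub>v v = \<mu> \<cdot>\<^sub>v v"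
    using e A by (auto simp: eigenvalue_def eigenvector_def)
  have "A *\<^sub>v v = - (\<mu> \<cdot>\<^sub>v v)" using v A
    by (metis carrier_matD(2) carrier_vecD uminus_mult_mat_vec uminus_uminus_vec)
  also have "\<dots> = (- \<mu>) \<cdot>\<^sub>v v" by (auto intro!: eq_vecI)
  finally show ?thesis using v A by (auto simp: eigenvalue_def eigenvector_def)
qed

text \<open>The lower bound is transferred to \<open>- A\<close>, whose eigenvalues are the
  negatives of those of \<open>A\<close>.\<close>

lemma form_le_lambda_max:
  assumes A: "A \<in> carrier_mat m m" and s: "symmetric_mat A" and v: "v \<in> carrier_vec m"
  shows "v \<bullet> (A *\<^sub>v v) \<le> lambda_max A * (v \<bullet> v)"
proof (cases "m = 0")
  case True
  with A v show ?thesis by (simp add: scalar_prod_def)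
next
  case False
  have "symmetric_mat (- A)" using s by (auto simp: symmetric_mat_def transpose_uminus)
  with False obtain \<mu> where \<mu>: "eigenvalue (- A) \<mu>"
      "\<And>v. v \<in> carrier_vec m \<Longrightarrow> \<mu> * (v \<bullet> v) \<le> v \<bullet> (- A *\<^sub>v v)"
    using symmetric_mat_min_eigenvalue[of "- A" m] A by auto
  have "- \<mu> \<le> lambda_max A" unfolding lambda_max_def
    using eigenvalue_uminus[OF A \<mu>(1)] card_finite_spectrum(1)[OF A]
    by (intro Max_ge) (auto simp: spectrum_def)
  then have "- \<mu> * (v \<bullet> v) \<le> lambda_max A * (v \<bullet> v)"
    by (intro mult_right_mono scalar_prod_self_nonneg)
  with \<mu>(2)[OF v] A v show ?thesis by simp
qed

section \<open>Entry bounds and perturbed linear systems\<close>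

lemma psd_entry_le:
  assumes A: "A \<in> carrier_mat m m" and s: "symmetric_mat A"
    and psd: "\<And>v. v \<in> carrier_vec m \<Longrightarrow> 0 \<le> v \<bullet> (A *\<^sub>v v)"
    and bound: "\<And>v. v \<in> carrier_vec m \<Longrightarrow> v \<bullet> (A *\<^sub>v v) \<le> K * (v \<bullet> v)"
    and ij: "i < m" "j < m"
  shows "\<bar>A $$ (i, j)\<bar> \<le> K"
proof -
  have e: "unit_vec m l \<bullet> (A *\<^sub>v unit_vec m l') = A $$ (l, l')" if "l < m" "l' < m" for l l'
    using A that by simp
  have d: "0 \<le> A $$ (l, l)" "A $$ (l, l) \<le> K" if "l < m" for l
    using psd[of "unit_vec m l"] bound[of "unit_vec m l"] A that by auto
  \<comment> \<open>Evaluated at unit vectors, Cauchy-Schwarz bounds an off-diagonal entry by the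
    diagonal ones, which are values of the form.\<close>
  have "(A $$ (i, j))\<^sup>2 \<le> A $$ (i, i) * A $$ (j, j)"
    using psd_Cauchy_Schwarz[OF A s psd, of "unit_vec m i" "unit_vec m j"] ij by (simp add: e)
  also have "\<dots> \<le> K * K" using d ij by (intro mult_mono) (auto intro: order_trans)
  finally have "(A $$ (i, j))\<^sup>2 \<le> K\<^sup>2" by (simp add: power2_eq_square)
  moreover have "K \<ge> 0" using d[OF ij(1)] by linarith
  ultimately show ?thesis by (simp add: abs_le_square_iff[symmetric])
qed

text \<open>Each row and column has at most three nonzero entries, so Schur's test applies with
  \<open>3 * K\<close>. For \<open>i = 0\<close> the index \<open>i - 1\<close> truncates to 0; the
  index set only becomes smaller.\<close>

lemma norm2_tridiagonal_le:
  assumes G: "(G :: real mat) \<in> carrier_mat m m" and v: "v \<in> carrier_vec m"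
    and zero: "\<And>i j. i < m \<Longrightarrow> j < m \<Longrightarrow> i + 1 < j \<or> j + 1 < i \<Longrightarrow> G $$ (i, j) = 0"
    and bound: "\<And>i j. i < m \<Longrightarrow> j < m \<Longrightarrow> \<bar>G $$ (i, j)\<bar> \<le> K" and K: "K \<ge> 0"
  shows "norm2 (G *\<^sub>v v) \<le> (3 * K) * norm2 v"
proof -
  have three: "(\<Sum>j<m. f j) \<le> 3 * K"
    if z: "\<And>j. j < m \<Longrightarrow> i + 1 < j \<or> j + 1 < i \<Longrightarrow> f j = 0" and f: "\<And>j. j < m \<Longrightarrow> f j \<le> K" for i f
  proof -
    have fin: "finite ({i - 1, i, i + 1} \<inter> {..<m})" by simp
    have "(\<Sum>j<m. f j) = (\<Sum>j \<in> {i - 1, i, i + 1} \<inter> {..<m}. f j)"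
      by (rule sum.mono_neutral_right) (auto intro!: z)
    also have "\<dots> \<le> (\<Sum>j \<in> {i - 1, i, i + 1} \<inter> {..<m}. K)" by (intro sum_mono f) auto
    also have "\<dots> = card ({i - 1, i, i + 1} \<inter> {..<m}) * K" by simp
    also have "\<dots> \<le> 3 * K"
    proof (rule mult_right_mono[OF _ K])
      have "card ({i - 1, i, i + 1} \<inter> {..<m}) \<le> card {i - 1, i, i + 1}" by (rule card_mono) auto
      also have "\<dots> \<le> 3" by (simp add: card_insert_if)
      finally show "real (card ({i - 1, i, i + 1} \<inter> {..<m})) \<le> 3" by simp
    qed
    finally show ?thesis .
  qed
  show ?thesis
  proof (rule norm2_mult_mat_vec_le[OF G v])
    show "(\<Sum>j<m. \<bar>G $$ (i, j)\<bar>) \<le> 3 * K" if "i < m" for i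
      by (rule three[of i]) (use that zero bound in auto)
    show "(\<Sum>i<m. \<bar>G $$ (i, j)\<bar>) \<le> 3 * K" if "j < m" for j
      by (rule three[of j]) (use that zero bound in auto)
  qed (use K in simp)
qed

text \<open>One factor \<open>norm2 v\<close> cancels from Cauchy-Schwarz. This replaces the bound
  \<open>1 / z\<close> for the norm of the inverse, without forming an inverse.\<close>

lemma coercive_norm2_le:
  assumes M: "M \<in> carrier_mat m m" and v: "v \<in> carrier_vec m"
    and coer: "z * (v \<bullet> v) \<le> v \<bullet> (M *\<^sub>v v)"
  shows "z * norm2 v \<le> norm2 (M *\<^sub>v v)"
proof (cases "norm2 v = 0")
  case True
  then show ?thesis by simp
next
  case False
  then have pos: "norm2 v > 0" using norm2_nonneg[of v] by linarith
  have "norm2 v * (z * norm2 v) \<le> v \<bullet> (M *\<^sub>v v)"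
    using coer by (simp add: norm2_square[symmetric] power2_eq_square mult_ac)
  also have "\<dots> \<le> norm2 v * norm2 (M *\<^sub>v v)"
    using scalar_prod_le_norm2[of v m "M *\<^sub>v v"] M v by auto
  finally show ?thesis using pos by simp
qed

text \<open>The perturbation costs at most \<open>K\<close> of the coercivity, so
  \<open>M + E\<close> keeps the constant \<open>z\<close>. Applied to \<open>y - x\<close>, it
  gives the difference of the right-hand sides minus \<open>E x\<close>; hence the perturbation term
  involves the exact solution rather than the computed one.\<close>

lemma perturbed_solution_error:
  assumes M: "M \<in> carrier_mat m m" and E: "E \<in> carrier_mat m m"
    and coer: "\<And>v. v \<in> carrier_vec m \<Longrightarrow> (z + K) * (v \<bullet> v) \<le> v \<bullet> (M *\<^sub>v v)"
    and small: "\<And>v. v \<in> carrier_vec m \<Longrightarrow> norm2 (E *\<^sub>v v) \<le> K * norm2 v"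
    and x: "x \<in> carrier_vec m" and y: "y \<in> carrier_vec m"
  shows "z * norm2 (y - x) \<le> norm2 ((M + E) *\<^sub>v y - M *\<^sub>v x) + K * norm2 x"
proof -
  define e where "e = y - x"
  have e: "e \<in> carrier_vec m" using x y by (simp add: e_def)
  have "\<bar>e \<bullet> (E *\<^sub>v e)\<bar> \<le> norm2 e * norm2 (E *\<^sub>v e)" using E e by (intro scalar_prod_le_norm2) auto
  also have "\<dots> \<le> norm2 e * (K * norm2 e)" by (intro mult_left_mono small e) auto
  finally have "\<bar>e \<bullet> (E *\<^sub>v e)\<bar> \<le> K * (e \<bullet> e)"
    by (simp add: norm2_square[symmetric] power2_eq_square mult_ac)
  then have "z * (e \<bullet> e) \<le> e \<bullet> (M *\<^sub>v e) + e \<bullet> (E *\<^sub>v e)"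
    using coer[OF e] by (simp add: algebra_simps abs_le_iff)
  also have "\<dots> = e \<bullet> ((M + E) *\<^sub>v e)"
    using M E e by (simp add: add_mult_distrib_mat_vec[of _ m m] scalar_prod_add_distrib[of _ m])
  finally have "z * norm2 e \<le> norm2 ((M + E) *\<^sub>v e)"
    using M E e by (intro coercive_norm2_le) auto
  also have "(M + E) *\<^sub>v e = ((M + E) *\<^sub>v y - M *\<^sub>v x) + (- 1) \<cdot>\<^sub>v (E *\<^sub>v x)"
    using M E x y unfolding e_def
    by (auto intro!: eq_vecI simp: mult_minus_distrib_mat_vec[of _ m m] add_mult_distrib_mat_vec[of _ m m] )
  also have "norm2 \<dots> \<le> norm2 ((M + E) *\<^sub>v y - M *\<^sub>v x) + norm2 ((- 1) \<cdot>\<^sub>v (E *\<^sub>v x))"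
    using M E x y by (intro norm2_triangle[of _ m] minus_carrier_vec mult_mat_vec_carrier add_carrier_mat smult_carrier_vec[THEN iffD2])
  also have "\<dots> \<le> norm2 ((M + E) *\<^sub>v y - M *\<^sub>v x) + K * norm2 x"
    using small[OF x] by (simp add: norm2_smult)
  finally show ?thesis by (simp add: e_def)
qed

section \<open>Continuants and the zeros of the polynomials\<close>

text \<open>\<open>continuant d e p l\<close> is the determinant of the tridiagonal matrix with diagonal
  \<open>d p, ..., d (p + l - 1)\<close>, where \<open>e j\<close> is the product of the two off-diagonal entries
  coupling \<open>j - 1\<close> and \<open>j\<close>.\<close>

fun continuant :: "(nat \<Rightarrow> 'a::comm_ring_1) \<Rightarrow> (nat \<Rightarrow> 'a) \<Rightarrow> nat \<Rightarrow> nat \<Rightarrow> 'a" where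
  "continuant d e p 0 = 1"
| "continuant d e p (Suc 0) = d p"
| "continuant d e p (Suc (Suc l)) =
    d (p + l + 1) * continuant d e p (Suc l) - e (p + l + 1) * continuant d e p l"

text \<open>The recursion with lengths and index as free variables, so that it can be matched before
  natural-number sums are normalised.\<close>

lemma continuant_rec:
  assumes "L = Suc (Suc l)" "L' = Suc l" "j = p + l + 1"
  shows "continuant d e p L = d j * continuant d e p L' - e j * continuant d e p l"
  using assms by simp

text \<open>Both continuants satisfy the same three-term recurrence in \<open>t\<close>. The
  difference of the cross products is their Casorati determinant, which each step multiplies by the
  next \<open>e\<close>.\<close>

lemma continuant_Euler_adjacent:
  fixes d e :: "nat \<Rightarrow> 'a::comm_ring_1"
  shows "continuant d e p (s + t + 2) * continuant d e (p + s + 1) t =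
    continuant d e p (s + t + 1) * continuant d e (p + s + 1) (t + 1)
    - (\<Prod>j = p + s + 1..p + s + t + 1. e j) * continuant d e p s"
proof (induction t)
  case 0
  show ?case by (simp add: algebra_simps)
next
  case (Suc t)
  let ?j = "p + s + t + 2"
  have "continuant d e p (s + Suc t + 2) =
      d ?j * continuant d e p (s + Suc t + 1) - e ?j * continuant d e p (s + t + 1)"
    by (rule continuant_rec) simp_all
  moreover have "continuant d e (p + s + 1) (Suc t + 1) =
      d ?j * continuant d e (p + s + 1) (Suc t) - e ?j * continuant d e (p + s + 1) t"
    by (rule continuant_rec) simp_all
  moreover have "(\<Prod>j = p + s + 1..p + s + Suc t + 1. e j) = (\<Prod>j = p + s + 1..p + s + t + 1. e j) * e ?j"
    by simp
  moreover have "continuant d e p (s + Suc t + 1) * continuant d e (p + s + 1) t =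
      continuant d e p (s + t + 1) * continuant d e (p + s + 1) (Suc t)
      - (\<Prod>j = p + s + 1..p + s + t + 1. e j) * continuant d e p s"
    using Suc.IH by (simp only: add_Suc_right Suc_eq_plus1[symmetric] add_2_eq_Suc')
  \<comment> \<open>The ring identity is stated for arbitrary elements, so that simplification does
    not unfold the continuants.\<close>
  moreover have "(D * X2 - E * X1) * k1 = X2 * (D * k1 - E * k0) - P * E * K"
    if "X2 * k0 = X1 * k1 - P * K" for D E X1 X2 k0 k1 P K :: 'a
    using arg_cong[OF that, of "\<lambda>z. E * z"] by (simp add: algebra_simps)
  ultimately show ?case by (simp only:)
qed

text \<open>All continuants containing \<open>w\<close> end at the same index and so obey the same
  second-order recurrence in \<open>w\<close>. It suffices to check \<open>w = 0\<close> and
  \<open>w = 1\<close>; both follow from the adjacent case.\<close>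

lemma continuant_Euler:
  fixes d e :: "nat \<Rightarrow> 'a::comm_ring_1"
  shows "continuant d e p (s + t + w + 2) * continuant d e (p + s + 1) t =
    continuant d e p (s + t + 1) * continuant d e (p + s + 1) (t + w + 1)
    - (\<Prod>j = p + s + 1..p + s + t + 1. e j) * continuant d e p s * continuant d e (p + s + t + 2) w"
proof (induction w rule: induct_nat_012)
  case 0
  show ?case using continuant_Euler_adjacent[of d e p s t] by simp
next
  case 1
  let ?j = "p + s + t + 2"
  have "continuant d e p (s + t + Suc 0 + 2) =
      d ?j * continuant d e p (s + t + 2) - e ?j * continuant d e p (s + t + 1)"
    by (rule continuant_rec) simp_all
  moreover have "continuant d e (p + s + 1) (t + Suc 0 + 1) =
      d ?j * continuant d e (p + s + 1) (t + 1) - e ?j * continuant d e (p + s + 1) t"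
    by (rule continuant_rec) simp_all
  moreover have "continuant d e ?j (Suc 0) = d ?j" by simp
  moreover have "(D * X2 - E * X1) * k0 = X1 * (D * k1 - E * k0) - P * K * D"
    if "X2 * k0 = X1 * k1 - P * K" for D E X1 X2 k0 k1 P K :: 'a
    using arg_cong[OF that, of "\<lambda>z. D * z"] by (simp add: algebra_simps)
  ultimately show ?case using continuant_Euler_adjacent[of d e p s t] by (simp only:)
next
  case (ge2 w)
  let ?j = "p + s + t + w + 3"
  have "continuant d e p (s + t + Suc (Suc w) + 2) =
      d ?j * continuant d e p (s + t + Suc w + 2) - e ?j * continuant d e p (s + t + w + 2)"
    by (rule continuant_rec) simp_all
  moreover have "continuant d e (p + s + 1) (t + Suc (Suc w) + 1) =
      d ?j * continuant d e (p + s + 1) (t + Suc w + 1) - e ?j * continuant d e (p + s + 1) (t + w + 1)"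
    by (rule continuant_rec) simp_all
  moreover have "continuant d e (p + s + t + 2) (Suc (Suc w)) =
      d ?j * continuant d e (p + s + t + 2) (Suc w) - e ?j * continuant d e (p + s + t + 2) w"
    by (rule continuant_rec) simp_all
  moreover have "(D * X1 - E * X0) * k = Y * (D * y1 - E * y0) - P * (D * w1 - E * w0)"
    if "X0 * k = Y * y0 - P * w0" "X1 * k = Y * y1 - P * w1" for D E X0 X1 k Y y0 y1 P w0 w1 :: 'a
    using arg_cong[OF that(1), of "\<lambda>z. E * z"] arg_cong[OF that(2), of "\<lambda>z. D * z"]
    by (simp add: algebra_simps)
  ultimately show ?case using ge2 by (simp only:)
qed

text \<open>The weight is the next off-diagonal entry, one place beyond the smaller block: it turns
  \<open>e Y = a\<^sup>2 Y\<close> into something smaller than \<open>a X\<close>, which is what the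
  induction needs. In particular the longer continuant is nonzero.\<close>

lemma continuant_diagonally_dominant:
  fixes d e a :: "nat \<Rightarrow> real"
  assumes "\<And>j. p \<le> j \<Longrightarrow> j \<le> p + l \<Longrightarrow> \<bar>a j\<bar> + \<bar>a (j + 1)\<bar> < \<bar>d j\<bar>"
    and "\<And>j. p < j \<Longrightarrow> j \<le> p + l \<Longrightarrow> e j = (a j)\<^sup>2"
  shows "\<bar>a (p + l + 1)\<bar> * \<bar>continuant d e p l\<bar> < \<bar>continuant d e p (Suc l)\<bar>"
  using assms
proof (induction l)
  case 0
  then show ?case using 0(1)[of p] by simp
next
  case (Suc l)
  define m where "m = p + l + 1"
  define X where "X = continuant d e p (Suc l)"
  define Y where "Y = continuant d e p l"
  have IH: "\<bar>a m\<bar> * \<bar>Y\<bar> < \<bar>X\<bar>" unfolding m_def X_def Y_def using Suc by simp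
  then have X: "0 < \<bar>X\<bar>" by (smt (verit) mult_nonneg_nonneg abs_ge_zero)
  have "\<bar>a m\<bar> * (\<bar>a m\<bar> * \<bar>Y\<bar>) \<le> \<bar>a m\<bar> * \<bar>X\<bar>" using IH by (intro mult_left_mono) auto
  moreover have "(\<bar>a m\<bar> + \<bar>a (m + 1)\<bar>) * \<bar>X\<bar> < \<bar>d m\<bar> * \<bar>X\<bar>"
    using Suc.prems(1)[of m] X by (intro mult_strict_right_mono) (auto simp: m_def)
  moreover have "\<bar>e m * Y\<bar> = \<bar>a m\<bar> * (\<bar>a m\<bar> * \<bar>Y\<bar>)"
    using Suc.prems(2)[of m] by (simp add: m_def abs_mult power2_eq_square)
  moreover have "\<bar>d m * X\<bar> - \<bar>e m * Y\<bar> \<le> \<bar>d m * X - e m * Y\<bar>" by (rule abs_triangle_ineq2)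
  ultimately have "\<bar>a (m + 1)\<bar> * \<bar>X\<bar> < \<bar>d m * X - e m * Y\<bar>"
    unfolding abs_mult[of "d m" X] distrib_right by linarith
  then show ?case by (simp add: m_def X_def Y_def add_ac)
qed

section \<open>Determinants of blocks and the defining recursion\<close>

lemma poly_continuant:
  "poly (continuant d e p l) x = continuant (\<lambda>j. poly (d j) x) (\<lambda>j. poly (e j) x) p l"
  by (induction d e p l rule: continuant.induct) simp_all

text \<open>The determinant of \<open>x I\<close> plus the principal block of \<open>R\<close> with
  \<open>l\<close> rows starting at row \<open>p\<close>, counted from 1.\<close>

definition block_poly :: "real mat \<Rightarrow> nat \<Rightarrow> nat \<Rightarrow> real poly" where
  "block_poly R = continuant (\<lambda>j. [:diag_entry R j, 1:]) (\<lambda>j. [:sub_entry R j * super_entry R (j - 1):])"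

text \<open>Block polynomials are monic, hence nonzero, which permits cancelling the divisor in the
  recursion.\<close>

lemma coeff_block_poly:
  "coeff (block_poly R p l) l = 1 \<and> (\<forall>j>l. coeff (block_poly R p l) j = 0)"
proof (induction l rule: induct_nat_012)
  case (ge2 l)
  then show ?case by (auto simp: block_poly_def coeff_pCons split: nat.splits)
qed (auto simp: block_poly_def coeff_pCons coeff_1 split: nat.splits)

lemma block_poly_nonzero: "block_poly R p l \<noteq> 0"
  using coeff_block_poly[of R p l] by (metis coeff_0 zero_neq_one)

text \<open>Shifting the superdiagonal product by one index pairs its factors with the subdiagonal
  ones and gives the product occurring in Euler's identity.\<close>

lemma alpha_gamma_prod:
  assumes "2 ^ s \<le> i"
  shows "alpha_prod R s i * gamma_prod R s (i - 2 ^ s) =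
    (\<Prod>j = i + 1 - 2 ^ s..i. sub_entry R j * super_entry R (j - 1))"
proof -
  obtain c where i: "i = c + 2 ^ s" using assms by (metis add.commute le_Suc_ex)
  have "gamma_prod R s (i - 2 ^ s) = (\<Prod>j = Suc c..Suc (c + 2 ^ s - 1). super_entry R (j - 1))"
    unfolding prod.shift_bounds_cl_Suc_ivl by (simp add: gamma_prod_def i)
  also have "Suc (c + 2 ^ s - 1) = c + 2 ^ s" by simp
  finally show ?thesis by (simp add: alpha_prod_def i prod.distrib Suc_diff_le)
qed

lemma const_poly_prod: "[:\<Prod>j\<in>A. f j:] = (\<Prod>j\<in>A. [:f j:])"
proof (induction A rule: infinite_finite_induct)
  case (insert x F)
  have "[:\<Prod>j\<in>insert x F. f j:] = Polynomial.smult (f x) [:\<Prod>j\<in>F. f j:]" using insert.hyps by simp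
  also have "\<dots> = (\<Prod>j\<in>insert x F. [:f j:])" unfolding insert.IH using insert.hyps by simp
  finally show ?case .
qed (simp_all add: one_pCons)

text \<open>Strong induction, since the recursion reaches two levels down. Two instances of Euler's
  identity show that the numerator is a signed multiple of the divisor, so the division is exact;
  each level contributes one factor \<open>- 1\<close>.\<close>

lemma B_poly_eq_block_poly:
  assumes "2 ^ s \<le> i"
  shows "B_poly R (Suc s) i = Polynomial.smult ((- 1) ^ s) (block_poly R (i + 1 - 2 ^ s) (2 ^ (s + 1) - 1))"
  using assms
proof (induction s arbitrary: i rule: less_induct)
  case (less s)
  show ?case
  proof (cases s)
    case 0
    then show ?thesis by (simp add: block_poly_def)
  next
    case (Suc s')
    define h :: nat where "h = 2 ^ s'"
    define q where "q = h div 2"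
    define g where "g = h - 1"
    define p where "p = i + 1 - 2 * h"
    \<comment> \<open>The whole block starts at \<open>p\<close> and has length
      \<open>4 * g + 3\<close>; the blocks of the previous two levels have lengths
      \<open>2 * g + 1\<close> and \<open>g\<close>.\<close>
    let ?K = "block_poly R"
    define \<rho> :: real where "\<rho> = (- 1) ^ s'"
    have h: "h \<ge> 1" "h = g + 1" by (simp_all add: h_def g_def)
    have i: "i + 1 = p + 2 * h" "i \<ge> 2 * h" using less.prems by (simp_all add: p_def Suc h_def)
    have \<rho>: "\<rho> * \<rho> = 1" unfolding \<rho>_def by (metis power_minus1_even mult_2 power_add)
    have len: "2 ^ (s' + 1) - 1 = 2 * g + 1" using h by (simp add: h_def)
    have upper: "B_poly R (Suc s') j = Polynomial.smult \<rho> (?K (j + 1 - h) (2 * g + 1))" if "h \<le> j" for j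
      using less.IH[of s' j] that Suc len by (simp add: h_def \<rho>_def)
    obtain \<tau> :: real where \<tau>: "\<tau> * \<tau> = 1"
      and lower: "\<And>j. q \<le> j \<Longrightarrow> B_poly R s' j = Polynomial.smult \<tau> (?K (j + 1 - q) g)"
    proof (cases s')
      case 0
      show ?thesis by (rule that[of 1]) (simp_all add: 0 g_def h_def block_poly_def)
    next
      case (Suc s'')
      have q: "q = 2 ^ s''" "g = 2 ^ (s'' + 1) - 1" by (simp_all add: q_def h_def g_def Suc)
      show ?thesis
      proof (rule that[of "(- 1) ^ s''"])
        show "(- 1) ^ s'' * (- 1) ^ s'' = (1 :: real)" by (metis power_minus1_even mult_2 power_add)
        show "B_poly R s' j = Polynomial.smult ((- 1) ^ s'') (?K (j + 1 - q) g)" if "q \<le> j" for j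
          using less.IH[of s'' j] that by (simp add: Suc \<open>s = Suc s'\<close> q)
      qed
    qed
    have q: "4 * q \<le> 2 * h" "s' = 0 \<and> g = 0 \<or> 2 * q = h"
      by (cases s'; simp add: q_def h_def g_def)+
    have K0: "?K j 0 = ?K j' 0" for j j' by (simp add: block_poly_def)
    have lows: "B_poly R s' (i + q) = Polynomial.smult \<tau> (?K (p + 2 * g + 2) g)"
      "B_poly R s' (i - 3 * q) = Polynomial.smult \<tau> (?K p g)"
      "B_poly R s' (i - q) = Polynomial.smult \<tau> (?K (p + g + 1) g)"
      "B_poly R s' (i + 3 * q) = Polynomial.smult \<tau> (?K (p + 3 * g + 3) g)"
    proof -
      \<comment> \<open>When \<open>q\<close> is one half rounded to 0, the start indices may
        differ, but then \<open>g = 0\<close> and the empty block does not depend on its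
        start.\<close>
      have *: "?K j g = ?K j' g" if "2 * q = h \<Longrightarrow> j = j'" for j j' using q that K0 by auto
      show "B_poly R s' (i + q) = Polynomial.smult \<tau> (?K (p + 2 * g + 2) g)"
        by (subst lower) (use i h q in \<open>auto intro!: arg_cong[of _ _ "Polynomial.smult \<tau>"] *\<close>)
      show "B_poly R s' (i - 3 * q) = Polynomial.smult \<tau> (?K p g)"
        by (subst lower) (use i h q in \<open>auto intro!: arg_cong[of _ _ "Polynomial.smult \<tau>"] *\<close>)
      show "B_poly R s' (i - q) = Polynomial.smult \<tau> (?K (p + g + 1) g)"
        by (subst lower) (use i h q in \<open>auto intro!: arg_cong[of _ _ "Polynomial.smult \<tau>"] *\<close>)
      show "B_poly R s' (i + 3 * q) = Polynomial.smult \<tau> (?K (p + 3 * g + 3) g)"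
        by (subst lower) (use i h q in \<open>auto intro!: arg_cong[of _ _ "Polynomial.smult \<tau>"] *\<close>)
    qed
    have ups: "B_poly R (Suc s') (i + h) = Polynomial.smult \<rho> (?K (p + 2 * g + 2) (2 * g + 1))"
      "B_poly R (Suc s') (i - h) = Polynomial.smult \<rho> (?K p (2 * g + 1))"
      "B_poly R (Suc s') i = Polynomial.smult \<rho> (?K (p + g + 1) (2 * g + 1))"
      by (subst upper; use i h in \<open>force intro!: arg_cong2[of _ _ _ _ ?K] arg_cong[of _ _ "Polynomial.smult \<rho>"]\<close>)+
    let ?e = "\<lambda>j. [:sub_entry R j * super_entry R (j - 1):]"
    define \<pi>1 where "\<pi>1 = [:alpha_prod R s' i * gamma_prod R s' (i - h):]"
    define \<pi>2 where "\<pi>2 = [:alpha_prod R s' (i + h) * gamma_prod R s' i:]"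
    have \<pi>1: "\<pi>1 = (\<Prod>j = p + g + 1..p + g + g + 1. ?e j)"
    proof -
      have "{p + g + 1..p + g + g + 1} = {i + 1 - h..i}" using i h by simp
      then show ?thesis unfolding \<pi>1_def const_poly_prod[symmetric]
        using alpha_gamma_prod[of s' i R] i by (simp only: h_def)
    qed
    have \<pi>2: "\<pi>2 = (\<Prod>j = p + (2 * g + 1) + 1..p + (2 * g + 1) + g + 1. ?e j)"
    proof -
      have "{p + (2 * g + 1) + 1..p + (2 * g + 1) + g + 1} = {i + h + 1 - h..i + h}" using i h by simp
      moreover have "alpha_prod R s' (i + h) * gamma_prod R s' (i + h - h) =
          (\<Prod>j = i + h + 1 - h..i + h. sub_entry R j * super_entry R (j - 1))"
        unfolding h_def by (rule alpha_gamma_prod) simp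
      ultimately show ?thesis
        by (simp only: \<pi>2_def const_poly_prod[symmetric] diff_add_inverse2)
    qed
    have E1: "?K p (3 * g + 2) * ?K (p + g + 1) g =
        ?K p (2 * g + 1) * ?K (p + g + 1) (2 * g + 1) - \<pi>1 * ?K p g * ?K (p + 2 * g + 2) g"
      using continuant_Euler[of "\<lambda>j. [:diag_entry R j, 1:]" ?e p g g g]
      unfolding \<pi>1 block_poly_def by (simp add: mult_2 numeral_3_eq_3 add_ac)
    have E2: "?K p (4 * g + 3) * ?K (p + 2 * g + 2) g =
        ?K p (3 * g + 2) * ?K (p + 2 * g + 2) (2 * g + 1) - \<pi>2 * ?K p (2 * g + 1) * ?K (p + 3 * g + 3) g"
      using continuant_Euler[of "\<lambda>j. [:diag_entry R j, 1:]" ?e p "2 * g + 1" g g]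
      unfolding \<pi>2 block_poly_def by (simp add: eval_nat_numeral add_ac)
    let ?D = "?K (p + g + 1) g * ?K (p + 2 * g + 2) g"
    have "B_poly R (Suc s) i = (Polynomial.smult \<rho> (\<pi>1 * ?K (p + 2 * g + 2) g * ?K p g * ?K (p + 2 * g + 2) (2 * g + 1)
        - ?K p (2 * g + 1) * ?K (p + g + 1) (2 * g + 1) * ?K (p + 2 * g + 2) (2 * g + 1)
        + \<pi>2 * ?K (p + g + 1) g * ?K (p + 3 * g + 3) g * ?K p (2 * g + 1))) div ?D"
      \<comment> \<open>The signs combine by \<open>\<rho>\<^sup>3 = \<rho>\<close> and
        \<open>\<tau>\<^sup>2 = 1\<close>, leaving a single factor \<open>\<rho>\<close> in the
        numerator.\<close>
      unfolding Suc B_poly.simps Let_def h_def[symmetric] q_def[symmetric] lows ups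
      using \<rho> \<tau> by (auto simp: \<pi>1_def \<pi>2_def square_eq_1_iff algebra_simps)
    also have "\<pi>1 * ?K (p + 2 * g + 2) g * ?K p g * ?K (p + 2 * g + 2) (2 * g + 1)
        - ?K p (2 * g + 1) * ?K (p + g + 1) (2 * g + 1) * ?K (p + 2 * g + 2) (2 * g + 1)
        + \<pi>2 * ?K (p + g + 1) g * ?K (p + 3 * g + 3) g * ?K p (2 * g + 1) = - (?K p (4 * g + 3) * ?D)"
    proof -
      \<comment> \<open>The block \<open>X\<close> of length \<open>3 * g + 2\<close> is eliminated
        between the two identities, the first multiplied by \<open>V\<close> and the second by
        \<open>S\<close>.\<close>
      have "P1 * Q * T * V - U * W * V + P2 * S * T' * U = - (F * (S * Q))"
        if "X * S = U * W - P1 * T * Q" "F * Q = X * V - P2 * U * T'"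
        for P1 P2 Q T T' U V W F S X :: "real poly"
        using arg_cong[OF that(1), of "\<lambda>z. z * V"] arg_cong[OF that(2), of "\<lambda>z. S * z"]
        by (simp add: algebra_simps)
      from this[OF E1 E2] show ?thesis .
    qed
    also have "Polynomial.smult \<rho> (- (?K p (4 * g + 3) * ?D)) = Polynomial.smult (- \<rho>) (?K p (4 * g + 3)) * ?D"
      by simp
    also have "\<dots> div ?D = Polynomial.smult (- \<rho>) (?K p (4 * g + 3))"
      by (rule nonzero_mult_div_cancel_right) (simp add: block_poly_nonzero)
    finally have "B_poly R (Suc s) i = Polynomial.smult (- \<rho>) (?K p (4 * g + 3))" .
    moreover have "4 * g + 3 = 2 ^ (s + 1) - 1" using h by (simp add: Suc h_def)
    moreover have "p = i + 1 - 2 ^ s" by (simp add: p_def h_def Suc)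
    moreover have "- \<rho> = (- 1) ^ s" by (simp add: \<rho>_def Suc)
    ultimately show ?thesis by (simp only:)
  qed
qed

section \<open>Location of the zeros\<close>

lemma gershgorin_max_ge:
  assumes "1 \<le> j" "j \<le> dim_row R"
  shows "diag_entry R j + (\<bar>sub_entry R j\<bar> + \<bar>sub_entry R (j + 1)\<bar>) \<le> gershgorin_max R"
proof -
  have "\<bar>diag_entry R j + (\<bar>sub_entry R j\<bar> + \<bar>sub_entry R (j + 1)\<bar>)\<bar> \<le> gershgorin_max R"
    unfolding gershgorin_max_def using assms by (intro Max_ge) auto
  then show ?thesis by linarith
qed

text \<open>For \<open>x < - 1\<close> the Gershgorin bound gives \<open>x + b\<^sub>j < -
  (\<bar>a\<^sub>j\<bar> + \<bar>a\<^sub>j\<^sub>+\<^sub>1\<bar>)\<close>, so the block is strictly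
  diagonally dominant and its determinant cannot vanish.\<close>

lemma B_poly_root_ge:
  assumes R: "R \<in> carrier_mat n n" and sym: "symmetric_mat R" and g: "gershgorin_max R \<le> 1"
    and i: "2 ^ s \<le> i" "i + 2 ^ s \<le> n + 1" and root: "poly (B_poly R (Suc s) i) x = 0"
  shows "x \<ge> - 1"
proof (rule ccontr)
  assume "\<not> x \<ge> - 1"
  define p where "p = i + 1 - 2 ^ s"
  define l :: nat where "l = 2 ^ (s + 1) - 2"
  have pl: "p + l \<le> n" "p \<ge> 1" using i by (simp_all add: p_def l_def)
  have "(2 :: nat) \<le> 2 ^ (s + 1)" by simp
  then have len: "2 ^ (s + 1) - 1 = Suc l" unfolding l_def by arith
  let ?d = "\<lambda>j. x + diag_entry R j" and ?e = "\<lambda>j. sub_entry R j * super_entry R (j - 1)"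
  have "continuant ?d ?e p (Suc l) = 0"
    using root unfolding B_poly_eq_block_poly[OF i(1)] len p_def[symmetric]
    by (simp add: block_poly_def poly_continuant add.commute)
  moreover have "\<bar>sub_entry R (p + l + 1)\<bar> * \<bar>continuant ?d ?e p l\<bar> < \<bar>continuant ?d ?e p (Suc l)\<bar>"
  proof (rule continuant_diagonally_dominant)
    fix j assume "p \<le> j" "j \<le> p + l"
    then show "\<bar>sub_entry R j\<bar> + \<bar>sub_entry R (j + 1)\<bar> < \<bar>x + diag_entry R j\<bar>"
      using gershgorin_max_ge[of j R] pl R g \<open>\<not> x \<ge> - 1\<close> by auto
  next
    fix j assume j: "p < j" "j \<le> p + l"
    have "R $$ (j - 1, j - 2) = transpose_mat R $$ (j - 1, j - 2)"
      using sym by (simp add: symmetric_mat_def)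
    then have "super_entry R (j - 1) = sub_entry R j"
      using j pl R by (auto simp: sub_entry_def super_entry_def numeral_2_eq_2)
    then show "?e j = (sub_entry R j)\<^sup>2" by (simp add: power2_eq_square)
  qed
  ultimately show False by (smt (verit) mult_nonneg_nonneg abs_ge_zero)
qed

section \<open>Error propagation\<close>

lemma g_bound_le:
  assumes "0 < u" "u \<le> 1 / 2000"
  shows "g_bound u \<le> 41 / 10 * u"
proof -
  have "u\<^sup>2 \<le> u * (1 / 2000)" unfolding power2_eq_square using assms by (intro mult_left_mono) auto
  moreover have "u ^ 3 \<le> u\<^sup>2" using assms by (intro power_decreasing) auto
  moreover have "41 / 10 * u * (1 - u) = 41 / 10 * u - 41 / 10 * u\<^sup>2"
    by (simp add: power2_eq_square right_diff_distrib)
  ultimately have "4 * u + 3 * u\<^sup>2 + u ^ 3 \<le> 41 / 10 * u * (1 - u)" using assms by linarith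
  then show ?thesis using assms by (simp add: g_bound_def pos_divide_le_eq)
qed

lemma shifted_mult_vec:
  assumes "(B :: real mat) \<in> carrier_mat m m" "v \<in> carrier_vec m"
  shows "(B - c \<cdot>\<^sub>m 1\<^sub>m m) *\<^sub>v v = B *\<^sub>v v - c \<cdot>\<^sub>v v"
  using assms by (simp add: minus_mult_distrib_mat_vec[of _ m m])
    (auto intro!: eq_vecI)

text \<open>The rounding error \<open>G\<close> and the error of the zero form one perturbation of norm at most
  \<open>33 u\<close>: the entries of the shifted matrix are at most \<open>1 + 101/100\<close>, so those of \<open>G\<close> are at most
  \<open>(41/10) (201/100) u\<close>; three of them meet in a row, and \<open>15/2 u\<close> is added. Since \<open>33 u \<le> sqrt u\<close>,
  the smallest eigenvalue of \<open>B\<close> absorbs it and the perturbed system is still coercive with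
  constant \<open>\<bar>\<xi>\<bar>\<close>.\<close>

lemma shifted_solve_error:
  assumes B: "B \<in> carrier_mat m m" and s: "symmetric_mat B" and tri: "tridiagonal_mat B"
    and lo: "\<And>v. v \<in> carrier_vec m \<Longrightarrow> sqrt u * (v \<bullet> v) \<le> v \<bullet> (B *\<^sub>v v)"
    and hi: "\<And>v. v \<in> carrier_vec m \<Longrightarrow> v \<bullet> (B *\<^sub>v v) \<le> v \<bullet> v"
    and u: "0 < u" "u \<le> 1 / 2000"
    and \<xi>: "- 1 \<le> \<xi>" "\<xi> < 0" and \<xi>t: "\<bar>\<xi>t - \<xi>\<bar> < 15 / 2 * u"
    and x: "x \<in> carrier_vec m" "(B - \<xi> \<cdot>\<^sub>m 1\<^sub>m m) *\<^sub>v x = f"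
    and y: "computed_solution u (B - \<xi>t \<cdot>\<^sub>m 1\<^sub>m m) f' y"
  shows "\<bar>\<xi>\<bar> * norm2 x \<le> norm2 f"
    and "\<bar>\<xi>\<bar> * norm2 (y - x) \<le> norm2 (f' - f) + 33 * u * norm2 x"
proof -
  define M where "M = B - \<xi> \<cdot>\<^sub>m 1\<^sub>m m"
  define A where "A = B - \<xi>t \<cdot>\<^sub>m 1\<^sub>m m"
  have M: "M \<in> carrier_mat m m" and A: "A \<in> carrier_mat m m" using B by (auto simp: M_def A_def)
  have "33 * u \<le> sqrt u"
  proof (rule real_le_rsqrt)
    have "1089 * (u * u) \<le> 1 * u" using u by (simp add: mult_right_mono)
    then show "(33 * u)\<^sup>2 \<le> u" by (simp add: power2_eq_square)
  qed
  have coer: "(\<bar>\<xi>\<bar> + 33 * u) * (v \<bullet> v) \<le> v \<bullet> (M *\<^sub>v v)" if v: "v \<in> carrier_vec m" for v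
  proof -
    have "33 * u * (v \<bullet> v) \<le> sqrt u * (v \<bullet> v)"
      using \<open>33 * u \<le> sqrt u\<close> by (intro mult_right_mono scalar_prod_self_nonneg)
    also note lo[OF v]
    finally have "33 * u * (v \<bullet> v) \<le> v \<bullet> (B *\<^sub>v v)" .
    moreover have "v \<bullet> (M *\<^sub>v v) = v \<bullet> (B *\<^sub>v v) - \<xi> * (v \<bullet> v)"
      unfolding M_def shifted_mult_vec[OF B v] using B v by (simp add: scalar_prod_minus_distrib[of _ m])
    ultimately show ?thesis using \<xi> by (simp add: algebra_simps)
  qed
  show "\<bar>\<xi>\<bar> * norm2 x \<le> norm2 f"
  proof -
    have "0 \<le> 33 * u * (x \<bullet> x)" using u by (simp add: scalar_prod_self_nonneg)
    then have "\<bar>\<xi>\<bar> * (x \<bullet> x) \<le> x \<bullet> (M *\<^sub>v x)" using coer[OF x(1)] by (simp add: algebra_simps)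
    from coercive_norm2_le[OF M x(1) this] show ?thesis using x(2) by (simp add: M_def)
  qed
  obtain G where y: "y \<in> carrier_vec m" and G: "G \<in> carrier_mat m m"
    "\<And>i j. i < m \<Longrightarrow> j < m \<Longrightarrow> \<bar>G $$ (i, j)\<bar> \<le> g_bound u * \<bar>A $$ (i, j)\<bar>" "(A + G) *\<^sub>v y = f'"
    using y A unfolding computed_solution_def A_def[symmetric] by auto
  have Bent: "\<bar>B $$ (i, j)\<bar> \<le> 1" if "i < m" "j < m" for i j
  proof (rule psd_entry_le[OF B s _ _ that])
    show "0 \<le> v \<bullet> (B *\<^sub>v v)" if "v \<in> carrier_vec m" for v
      using lo[OF that] u scalar_prod_self_nonneg[of v] by (meson order_trans mult_nonneg_nonneg real_sqrt_ge_zero less_imp_le)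
  qed (use hi in simp)
  have \<xi>t_bd: "\<bar>\<xi>t\<bar> \<le> 101 / 100" using \<xi>t \<xi> u by linarith
  have Gent: "\<bar>G $$ (i, j)\<bar> \<le> 41 / 10 * u * (201 / 100)" if ij: "i < m" "j < m" for i j
  proof -
    have "A $$ (i, j) = B $$ (i, j) - (if i = j then \<xi>t else 0)"
      using B ij by (simp add: A_def)
    then have "\<bar>A $$ (i, j)\<bar> \<le> \<bar>B $$ (i, j)\<bar> + \<bar>\<xi>t\<bar>"
      by (cases "i = j") (simp_all add: abs_triangle_ineq4)
    then have "\<bar>A $$ (i, j)\<bar> \<le> 201 / 100" using Bent[OF ij] \<xi>t_bd by linarith
    then have "g_bound u * \<bar>A $$ (i, j)\<bar> \<le> 41 / 10 * u * (201 / 100)"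
      using g_bound_le[OF u] u by (intro mult_mono) auto
    with G(2)[OF ij] show ?thesis by simp
  qed
  have Gzero: "G $$ (i, j) = 0" if ij: "i < m" "j < m" "i + 1 < j \<or> j + 1 < i" for i j
  proof -
    have "A $$ (i, j) = 0" using ij tri B unfolding A_def tridiagonal_mat_def by auto
    then show ?thesis using G(2)[OF ij(1,2)] by simp
  qed
  define E where "E = (\<xi> - \<xi>t) \<cdot>\<^sub>m 1\<^sub>m m + G"
  have E: "E \<in> carrier_mat m m" using G by (simp add: E_def)
  have ME: "M + E = A + G"
    using B G(1) by (intro eq_matI) (auto simp: M_def A_def E_def)
  have small: "norm2 (E *\<^sub>v v) \<le> 33 * u * norm2 v" if v: "v \<in> carrier_vec m" for v
  proof -
    have "E *\<^sub>v v = (\<xi> - \<xi>t) \<cdot>\<^sub>v v + G *\<^sub>v v"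
      using v G unfolding E_def
      by (subst add_mult_distrib_mat_vec[of _ m m]) (auto intro!: eq_vecI)
    then have "norm2 (E *\<^sub>v v) \<le> \<bar>\<xi> - \<xi>t\<bar> * norm2 v + norm2 (G *\<^sub>v v)"
      using norm2_triangle[of "(\<xi> - \<xi>t) \<cdot>\<^sub>v v" m "G *\<^sub>v v"] v G by (simp add: norm2_smult)
    also have "\<dots> \<le> 15 / 2 * u * norm2 v + 3 * (41 / 10 * u * (201 / 100)) * norm2 v"
      using less_imp_le[OF \<xi>t[unfolded abs_minus_commute[of \<xi>t]]] u
      by (intro add_mono mult_right_mono norm2_tridiagonal_le[OF G(1) v Gzero Gent]) auto
    also have "\<dots> = (15 / 2 + 3 * (41 / 10 * (201 / 100))) * (u * norm2 v)" by (simp add: algebra_simps)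
    also have "\<dots> \<le> 33 * (u * norm2 v)" using u by (intro mult_right_mono) auto
    finally show ?thesis by simp
  qed
  have "(M + E) *\<^sub>v y = f'" "M *\<^sub>v x = f" using G x ME by (simp_all add: M_def)
  with perturbed_solution_error[OF M E coer small x(1) y]
  show "\<bar>\<xi>\<bar> * norm2 (y - x) \<le> norm2 (f' - f) + 33 * u * norm2 x" by simp
qed

text \<open>Both bounds are propagated together. The local error at step \<open>j\<close> is a
  multiple of \<open>X j\<close>, whose bound already contains the full product up to
  \<open>j\<close>; dividing by \<open>z j\<close> therefore adds just \<open>1 / z j\<close> to the
  sum.\<close>

lemma error_recursion:
  fixes X e a z :: "nat \<Rightarrow> real"
  assumes z: "\<And>j. 1 \<le> j \<Longrightarrow> j \<le> N \<Longrightarrow> z j > 0" and a: "\<And>j. a j \<ge> 0" and \<kappa>: "\<kappa> \<ge> 0"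
    and X: "\<And>j. 1 \<le> j \<Longrightarrow> j \<le> N \<Longrightarrow> z j * X j \<le> a j * X (j - 1)"
    and e: "\<And>j. 1 \<le> j \<Longrightarrow> j \<le> N \<Longrightarrow> z j * e j \<le> a j * e (j - 1) + \<kappa> * X j"
  shows "e N \<le> (\<Prod>j = 1..N. a j / z j) * (e 0 + \<kappa> * (\<Sum>j = 1..N. 1 / z j) * X 0)"
proof -
  have "X j \<le> (\<Prod>l = 1..j. a l / z l) * X 0 \<and>
      e j \<le> (\<Prod>l = 1..j. a l / z l) * (e 0 + \<kappa> * (\<Sum>l = 1..j. 1 / z l) * X 0)" if "j \<le> N" for j
    using that
  proof (induction j)
    case 0
    show ?case by simp
  next
    case (Suc j)
    let ?P = "\<Prod>l = 1..j. a l / z l" and ?S = "\<Sum>l = 1..j. 1 / z l"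
    let ?c = "a (Suc j) / z (Suc j)"
    have zj: "z (Suc j) > 0" and c: "?c \<ge> 0" using z[of "Suc j"] a[of "Suc j"] Suc.prems by auto
    have IH: "X j \<le> ?P * X 0" "e j \<le> ?P * (e 0 + \<kappa> * ?S * X 0)" using Suc by auto
    have "X (Suc j) \<le> ?c * X j"
      using X[of "Suc j"] Suc.prems zj by (simp add: pos_le_divide_eq mult.commute)
    also have "\<dots> \<le> ?c * (?P * X 0)" by (rule mult_left_mono[OF IH(1) c])
    finally have 1: "X (Suc j) \<le> ?c * (?P * X 0)" .
    have "e (Suc j) \<le> (a (Suc j) * e j + \<kappa> * X (Suc j)) / z (Suc j)"
      using e[of "Suc j"] Suc.prems zj by (simp add: pos_le_divide_eq mult.commute)
    also have "\<dots> = ?c * e j + \<kappa> / z (Suc j) * X (Suc j)" by (simp add: add_divide_distrib)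
    also have "\<dots> \<le> ?c * (?P * (e 0 + \<kappa> * ?S * X 0)) + \<kappa> / z (Suc j) * (?c * (?P * X 0))"
      using \<kappa> zj by (intro add_mono mult_left_mono IH(2) 1 c) auto
    also have "\<dots> = (?P * ?c) * (e 0 + \<kappa> * (?S + 1 / z (Suc j)) * X 0)"
    proof -
      have "c * (P * (e0 + \<kappa> * S * X0)) + \<kappa> / y * (c * (P * X0)) = (P * c) * (e0 + \<kappa> * (S + 1 / y) * X0)"
        for c P e0 S X0 y by (simp add: distrib_left distrib_right mult_ac)
      then show ?thesis .
    qed
    finally show ?case using 1 by (simp add: mult_ac)
  qed
  then show ?thesis by blast
qed

theorem theorem4p5:
  shows "\<exists>u0::real. u0 > 0 \<and>
    (\<forall>u::real. 0 < u \<and> u \<le> u0 \<longrightarrow>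
      (\<forall>(k::nat) (n::nat) (m::nat) (B::real mat) (R::real mat) (r::nat) (i::nat)
        (\<xi>::nat \<Rightarrow> real) (\<epsilon>::real) (\<xi>t::nat \<Rightarrow> real) (b::real vec) (bt::real vec) (\<delta>::real)
        (x::nat \<Rightarrow> real vec) (xh::nat \<Rightarrow> real vec).
        k \<ge> 2 \<and> n = 2 ^ k - 1 \<and> m \<ge> 1 \<and>
        B \<in> carrier_mat m m \<and> R \<in> carrier_mat n n \<and>
        condition1 B R \<and> condition2 u B R \<and>
        r \<le> k - 2 \<and> i \<in> (\<lambda>t. t * 2 ^ (r + 1)) ` {1..2 ^ (k - r - 1) - 1} \<and>
        proots (B_poly R r (i - 2 ^ r div 2)) = image_mset \<xi> (mset_set {1..2 ^ r - 1}) \<and>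
        antimono_on {1..2 ^ r - 1} \<xi> \<and> (\<forall>j \<in> {1..2 ^ r - 1}. \<xi> j < 0) \<and>
        \<epsilon> = 15 / 2 * u \<and>
        (\<forall>j \<in> {1..2 ^ r - 1}. \<xi>t j < 0 \<and> \<bar>\<xi>t j - \<xi> j\<bar> < \<epsilon>) \<and>
        b \<in> carrier_vec m \<and> bt \<in> carrier_vec m \<and> norm2 (bt - b) < \<delta> \<and>
        x 0 = b \<and>
        (\<forall>j \<in> {1..2 ^ r - 1}. x j \<in> carrier_vec m \<and>
          (B - \<xi> (2 ^ r - j) \<cdot>\<^sub>m 1\<^sub>m m) *\<^sub>v x j = sub_entry R (i - 2 ^ r + j) \<cdot>\<^sub>v x (j - 1)) \<and>
        xh 0 = bt \<and>
        (\<forall>j \<in> {1..2 ^ r - 1}.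
          computed_solution u (B - \<xi>t (2 ^ r - j) \<cdot>\<^sub>m 1\<^sub>m m)
            (sub_entry R (i - 2 ^ r + j) \<cdot>\<^sub>v xh (j - 1)) (xh j))
        \<longrightarrow>
        norm2 (xh (2 ^ r - 1) - x (2 ^ r - 1))
          < C2 R r i \<xi> * (\<delta> + 41 * u * C3 r \<xi> * norm2 b)))"
proof (intro exI[of _ "1 / 2000"] conjI allI impI)
  \<comment> \<open>The decisive requirement is \<open>33 * u \<le> sqrt u\<close>, that is
    \<open>1089 * u \<le> 1\<close>. The bounds \<open>g_bound u \<le> 41 / 10 * u\<close> and
    \<open>15 / 2 * u \<le> 1 / 100\<close> also hold in this range.\<close>
  show "(0 :: real) < 1 / 2000" by simp
  fix u :: real and k n m :: nat and B R :: "real mat" and r i :: nat and \<xi> :: "nat \<Rightarrow> real"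
    and \<epsilon> :: real and \<xi>t :: "nat \<Rightarrow> real" and b bt :: "real vec" and \<delta> :: real
    and x xh :: "nat \<Rightarrow> real vec"
  define N :: nat where "N = 2 ^ r - 1"
  have N: "2 ^ r = N + 1" by (simp add: N_def)
  assume u: "0 < u \<and> u \<le> 1 / 2000"
  assume *: "k \<ge> 2 \<and> n = 2 ^ k - 1 \<and> m \<ge> 1 \<and>
        B \<in> carrier_mat m m \<and> R \<in> carrier_mat n n \<and>
        condition1 B R \<and> condition2 u B R \<and>
        r \<le> k - 2 \<and> i \<in> (\<lambda>t. t * 2 ^ (r + 1)) ` {1..2 ^ (k - r - 1) - 1} \<and>
        proots (B_poly R r (i - 2 ^ r div 2)) = image_mset \<xi> (mset_set {1..2 ^ r - 1}) \<and>
        antimono_on {1..2 ^ r - 1} \<xi> \<and> (\<forall>j \<in> {1..2 ^ r - 1}. \<xi> j < 0) \<and>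
        \<epsilon> = 15 / 2 * u \<and>
        (\<forall>j \<in> {1..2 ^ r - 1}. \<xi>t j < 0 \<and> \<bar>\<xi>t j - \<xi> j\<bar> < \<epsilon>) \<and>
        b \<in> carrier_vec m \<and> bt \<in> carrier_vec m \<and> norm2 (bt - b) < \<delta> \<and>
        x 0 = b \<and>
        (\<forall>j \<in> {1..2 ^ r - 1}. x j \<in> carrier_vec m \<and>
          (B - \<xi> (2 ^ r - j) \<cdot>\<^sub>m 1\<^sub>m m) *\<^sub>v x j = sub_entry R (i - 2 ^ r + j) \<cdot>\<^sub>v x (j - 1)) \<and>
        xh 0 = bt \<and>
        (\<forall>j \<in> {1..2 ^ r - 1}.
          computed_solution u (B - \<xi>t (2 ^ r - j) \<cdot>\<^sub>m 1\<^sub>m m)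
            (sub_entry R (i - 2 ^ r + j) \<cdot>\<^sub>v xh (j - 1)) (xh j))"
  then have k: "k \<ge> 2" "n = 2 ^ k - 1" and B: "B \<in> carrier_mat m m" and R: "R \<in> carrier_mat n n"
    and c1: "condition1 B R" and c2: "condition2 u B R" and r: "r \<le> k - 2"
    and i: "i \<in> (\<lambda>t. t * 2 ^ (r + 1)) ` {1..2 ^ (k - r - 1) - 1}"
    and zeros: "proots (B_poly R r (i - 2 ^ r div 2)) = image_mset \<xi> (mset_set {1..2 ^ r - 1})"
    and neg: "\<And>j. j \<in> {1..N} \<Longrightarrow> \<xi> j < 0"
    and b: "b \<in> carrier_vec m" "bt \<in> carrier_vec m" "norm2 (bt - b) < \<delta>" "x 0 = b" "xh 0 = bt"
    and x: "\<And>j. j \<in> {1..N} \<Longrightarrow> x j \<in> carrier_vec m"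
      "\<And>j. j \<in> {1..N} \<Longrightarrow> (B - \<xi> (2 ^ r - j) \<cdot>\<^sub>m 1\<^sub>m m) *\<^sub>v x j = sub_entry R (i - 2 ^ r + j) \<cdot>\<^sub>v x (j - 1)"
    and xh: "\<And>j. j \<in> {1..N} \<Longrightarrow> computed_solution u (B - \<xi>t (2 ^ r - j) \<cdot>\<^sub>m 1\<^sub>m m)
            (sub_entry R (i - 2 ^ r + j) \<cdot>\<^sub>v xh (j - 1)) (xh j)"
    by (auto simp: N_def)
  have approx: "\<bar>\<xi>t j - \<xi> j\<bar> < 15 / 2 * u" if "j \<in> {1..N}" for j
  proof -
    have "\<epsilon> = 15 / 2 * u" "\<forall>j \<in> {1..N}. \<xi>t j < 0 \<and> \<bar>\<xi>t j - \<xi> j\<bar> < \<epsilon>"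
      using * unfolding N_def by blast+
    with that show ?thesis by blast
  qed
  obtain t where t: "i = t * 2 ^ (r + 1)" "1 \<le> t" "t \<le> 2 ^ (k - r - 1) - 1" using i by auto
  have i_lo: "2 * 2 ^ r \<le> i" using t by simp
  \<comment> \<open>With \<open>i_lo\<close>, this keeps all blocks and subdiagonal indices used
    below inside the matrix and prevents truncated subtraction.\<close>
  have i_hi: "i + 2 * 2 ^ r \<le> n + 1"
  proof -
    have "t + 1 \<le> 2 ^ (k - r - 1)" using t by simp
    then have "(t + 1) * 2 ^ (r + 1) \<le> 2 ^ (k - r - 1) * 2 ^ (r + 1)" by (rule mult_right_mono) simp
    also have "\<dots> = 2 ^ ((k - r - 1) + (r + 1))" by (rule power_add[symmetric])
    also have "(k - r - 1) + (r + 1) = k" using r k by simp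
    finally show ?thesis using k t by (simp add: algebra_simps)
  qed
  have lo: "sqrt u * (v \<bullet> v) \<le> v \<bullet> (B *\<^sub>v v)" and hi: "v \<bullet> (B *\<^sub>v v) \<le> v \<bullet> v"
    if v: "v \<in> carrier_vec m" for v
  proof -
    have s: "symmetric_mat B" using c1 by (simp add: condition1_def)
    have "sqrt u * (v \<bullet> v) \<le> lambda_min B * (v \<bullet> v)" "lambda_max B * (v \<bullet> v) \<le> 1 * (v \<bullet> v)"
      using c2 unfolding condition2_def by (blast intro: mult_right_mono scalar_prod_self_nonneg)+
    with lambda_min_le_form[OF B s v] form_le_lambda_max[OF B s v]
    show "sqrt u * (v \<bullet> v) \<le> v \<bullet> (B *\<^sub>v v)" "v \<bullet> (B *\<^sub>v v) \<le> v \<bullet> v" by simp_all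
  qed
  \<comment> \<open>For \<open>r = 0\<close> there are no zeros. Otherwise \<open>r = s + 1\<close>,
    and the block is centred at \<open>i - 2 ^ s\<close>.\<close>
  have ge: "- 1 \<le> \<xi> j" if j: "j \<in> {1..N}" for j
  proof (cases r)
    case 0
    with j show ?thesis by (simp add: N_def)
  next
    case (Suc s)
    have "\<xi> j \<in># proots (B_poly R (Suc s) (i - 2 ^ s))"
      using zeros j by (simp add: Suc N_def)
    then have "poly (B_poly R (Suc s) (i - 2 ^ s)) (\<xi> j) = 0"
      by (cases "B_poly R (Suc s) (i - 2 ^ s) = 0") auto
    then show ?thesis
      using c1 c2 i_lo i_hi
      by (intro B_poly_root_ge[OF R, of s "i - 2 ^ s"]) (auto simp: condition1_def condition2_def Suc)
  qed
  define a where "a j = \<bar>sub_entry R (i - 2 ^ r + j)\<bar>" for j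
  \<comment> \<open>Step \<open>j\<close> uses the zero numbered \<open>2 ^ r - j\<close>, so the
    zeros enter in reverse order; \<open>C2\<close> and \<open>C3\<close> are matched later by this
    reflection.\<close>
  define z where "z j = \<bar>\<xi> (2 ^ r - j)\<bar>" for j
  have reflect: "2 ^ r - j \<in> {1..N}" if "j \<in> {1..N}" for j using that by (auto simp: N)
  have carrier: "x j \<in> carrier_vec m" "xh j \<in> carrier_vec m" if "j \<le> N" for j
    using that b x(1)[of j] xh[of j] B
    by (cases "j = 0"; auto simp: computed_solution_def)+
  have step: "z j * norm2 (x j) \<le> a j * norm2 (x (j - 1))"
    "z j * norm2 (xh j - x j) \<le> a j * norm2 (xh (j - 1) - x (j - 1)) + 33 * u * norm2 (x j)"
    if "1 \<le> j" "j \<le> N" for j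
  proof -
    have j: "j \<in> {1..N}" and j1: "j - 1 \<le> N" using that by simp_all
    let ?c = "sub_entry R (i - 2 ^ r + j)"
    have "?c \<cdot>\<^sub>v xh (j - 1) - ?c \<cdot>\<^sub>v x (j - 1) = ?c \<cdot>\<^sub>v (xh (j - 1) - x (j - 1))"
      using carrier(1)[OF j1] carrier(2)[OF j1] by (auto intro!: eq_vecI simp: right_diff_distrib)
    then have d: "norm2 (?c \<cdot>\<^sub>v xh (j - 1) - ?c \<cdot>\<^sub>v x (j - 1)) = a j * norm2 (xh (j - 1) - x (j - 1))"
      by (simp add: norm2_smult a_def)
    have BB: "symmetric_mat B" "tridiagonal_mat B" using c1 by (auto simp: condition1_def)
    note E = shifted_solve_error[OF B BB lo hi conjunct1[OF u] conjunct2[OF u] ge neg approx x xh,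
      OF _ _ reflect[OF j] reflect[OF j] reflect[OF j] j j j]
    show "z j * norm2 (x j) \<le> a j * norm2 (x (j - 1))"
      using E(1) by (simp add: z_def a_def norm2_smult)
    show "z j * norm2 (xh j - x j) \<le> a j * norm2 (xh (j - 1) - x (j - 1)) + 33 * u * norm2 (x j)"
      using E(2) unfolding d by (simp add: z_def)
  qed
  have err: "norm2 (xh N - x N) \<le> (\<Prod>j = 1..N. a j / z j) *
      (norm2 (xh 0 - x 0) + 33 * u * (\<Sum>j = 1..N. 1 / z j) * norm2 (x 0))"
  proof (rule error_recursion[where X = "\<lambda>j. norm2 (x j)" and e = "\<lambda>j. norm2 (xh j - x j)"])
    show "z j > 0" if "1 \<le> j" "j \<le> N" for j
      using neg[OF reflect, of j] that by (simp add: z_def)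
  qed (use step u in \<open>simp_all add: a_def\<close>)
  have C2: "C2 R r i \<xi> = (\<Prod>j = 1..N. a j / z j)"
    unfolding C2_def N_def[symmetric] a_def z_def
    by (rule prod.reindex_bij_witness[of _ "\<lambda>j. 2 ^ r - j" "\<lambda>j. 2 ^ r - j"])
      (use i_lo in \<open>auto simp: N\<close>)
  have C3: "C3 r \<xi> = (\<Sum>j = 1..N. 1 / z j)"
    unfolding C3_def N_def[symmetric] z_def
    by (rule sum.reindex_bij_witness[of _ "\<lambda>j. 2 ^ r - j" "\<lambda>j. 2 ^ r - j"]) (auto simp: N)
  \<comment> \<open>Strict positivity, from the nonzero subdiagonal entries, carries the strict
    inequality for the initial error over to the result.\<close>
  have C2_pos: "C2 R r i \<xi> > 0"
    unfolding C2_def N_def[symmetric]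
  proof (rule prod_pos)
    fix j assume j: "j \<in> {1..N}"
    have "i - j \<in> {2..dim_row R}" using j i_lo i_hi R by (auto simp: N)
    then have "sub_entry R (i - j) \<noteq> 0" using c1 by (simp add: condition1_def)
    then show "0 < \<bar>sub_entry R (i - j)\<bar> / \<bar>\<xi> j\<bar>" using neg[OF j] by (intro divide_pos_pos) simp_all
  qed
  have C3_nonneg: "C3 r \<xi> \<ge> 0" by (auto simp: C3_def intro!: sum_nonneg)
  \<comment> \<open>Strictness comes from the initial error; the constant 33 is relaxed to
    41.\<close>
  have "norm2 (bt - b) + 33 * u * C3 r \<xi> * norm2 b < \<delta> + 41 * u * C3 r \<xi> * norm2 b"
    using b(3) u C3_nonneg by (intro add_less_le_mono mult_right_mono) auto
  then have "C2 R r i \<xi> * (norm2 (bt - b) + 33 * u * C3 r \<xi> * norm2 b)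
      < C2 R r i \<xi> * (\<delta> + 41 * u * C3 r \<xi> * norm2 b)"
    using C2_pos by (rule mult_strict_left_mono)
  with err[folded C2 C3, unfolded b(4,5)] show "norm2 (xh (2 ^ r - 1) - x (2 ^ r - 1))
          < C2 R r i \<xi> * (\<delta> + 41 * u * C3 r \<xi> * norm2 b)"
    unfolding N_def[symmetric] by (rule le_less_trans)
qed

end
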